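(* Let $\mathcal{A}$ be an abelian category and let $(\mathcal{C}, \mathcal{D})$, $(\mathcal{C}', \mathcal{D}')$ be torsion pairs in $\mathcal{A}$ with $\mathcal{C}\subseteq\mathcal{C}'$. (a) If $(\mathcal{X}, \mathcal{Y})$ is a functorially finite torsion pair in $\mathcal{A}$ such that $\mathcal{C}\subseteq \mathcal{X} \subseteq \mathcal{C}'$, then $(\mathcal{X}\cap \mathcal{D}, \mathcal{Y} \cap \mathcal{C}')$ is a functorially finite torsion pair in $\mathcal{C}' \cap \mathcal{D}$. (b) Suppose that $\mathcal{A}$ has enough projectives and injectives and that $(\mathcal{C}, \mathcal{D})$ and $(\mathcal{C}', \mathcal{D}')$ are functorially finite as torsion pairs in $\mathcal{A}$. If $(\mathcal{T}, \mathcal{F})$ is a functorially finite torsion pair in $\mathcal{C}' \cap \mathcal{D}$, then $(\mathcal{C}\ast \mathcal{T}, \mathcal{F} \ast \mathcal{D}')$ is a functorially finite torsion pair in $\mathcal{A}$.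
   Context: An additive category is pre-abelian if every morphism has a kernel and a cokernel. A short exact sequence $0 \to X \xrightarrow{f} Y \xrightarrow{g} Z \to 0$ in a pre-abelian category is a composable pair with $f$ a kernel of $g$ and $g$ a cokernel of $f$. A torsion pair in a pre-abelian category $\mathcal{B}$ is an ordered pair $(\mathcal{T},\mathcal{F})$ of full subcategories (closed under isomorphism) such that $\mathrm{Hom}_{\mathcal{B}}(T,F)=0$ for all $T\in\mathcal{T}$, $F\in\mathcal{F}$, and for every $M \in \mathcal{B}$ there is a short exact sequence $0 \to {}_{\mathcal{T}}M \to M \to M_{\mathcal{F}} \to 0$ in $\mathcal{B}$ with ${}_{\mathcal{T}}M\in\mathcal{T}$ and $M_{\mathcal{F}}\in\mathcal{F}$. The full subcategory $\mathcal{C}'\cap\mathcal{D}$ of $\mathcal{A}$ is pre-abelian. A full subcategory $\mathcal{X}\subseteq\mathcal{B}$ is contravariantly finite in $\mathcal{B}$ if each $M\in\mathcal{B}$ has a right $\mathcal{X}$-approximation, i.e. a morphism $X\to M$ with $X\in\mathcal{X}$ through which every morphism $X'\to M$ with $X'\in\mathcal{X}$ factors. Covariantly finite is defined dually (left approximations), and functorially finite means both. A torsion pair $(\mathcal{T},\mathcal{F})$ in $\mathcal{B}$ is functorially finite if both $\mathcal{T}$ and $\mathcal{F}$ are functorially finite in $\mathcal{B}$. For subcategories $\mathcal{U},\mathcal{V}$ of $\mathcal{A}$, $\mathcal{U}\ast\mathcal{V}$ is the full subcategory of objects $M$ for which there is a short exact sequence $0\to M'\to M\to M''\to 0$ in $\mathcal{A}$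 with $M'\in\mathcal{U}$ and $M''\in\mathcal{V}$. *)

theory Defs
  imports "HOL-Algebra.Group"
begin

(* Categories whose hom-sets carry an addition. Hom-sets are pairwise disjoint (every arrow has one
   domain and one codomain), composition is written in the usual order (g after f), and the values
   of Comp and Plus outside composable resp. parallel pairs are irrelevant. *)

record ('o, 'm) precat =
  Obj :: "'o set"
  Arr :: "'m set"
  Dom :: "'m \<Rightarrow> 'o"
  Cod :: "'m \<Rightarrow> 'o"
  Ide :: "'o \<Rightarrow> 'm"
  Comp :: "'m \<Rightarrow> 'm \<Rightarrow> 'm"  (infixl "\<cdot>\<index>" 70)
  Plus :: "'m \<Rightarrow> 'm \<Rightarrow> 'm"
  Zero :: "'o \<Rightarrow> 'o \<Rightarrow> 'm"

definition Hom :: "('o, 'm, 'x) precat_scheme \<Rightarrow> 'o \<Rightarrow> 'o \<Rightarrow> 'm set" where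
  "Hom A X Y = {f \<in> Arr A. Dom A f = X \<and> Cod A f = Y}"

definition hom_group :: "('o, 'm, 'x) precat_scheme \<Rightarrow> 'o \<Rightarrow> 'o \<Rightarrow> 'm monoid" where
  "hom_group A X Y = \<lparr>carrier = Hom A X Y, monoid.mult = Plus A, one = Zero A X Y\<rparr>"

locale category =
  fixes A :: "('o, 'm, 'x) precat_scheme" (structure)
  assumes Dom_Obj: "f \<in> Arr A \<Longrightarrow> Dom A f \<in> Obj A"
    and Cod_Obj: "f \<in> Arr A \<Longrightarrow> Cod A f \<in> Obj A"
    and Ide_Hom: "X \<in> Obj A \<Longrightarrow> Ide A X \<in> Hom A X X"
    and Comp_Hom: "\<lbrakk>f \<in> Hom A X Y; g \<in> Hom A Y Z\<rbrakk> \<Longrightarrow> g \<cdot> f \<in> Hom A X Z"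
    and Comp_Ide: "f \<in> Hom A X Y \<Longrightarrow> f \<cdot> Ide A X = f"
    and Ide_Comp: "f \<in> Hom A X Y \<Longrightarrow> Ide A Y \<cdot> f = f"
    and Comp_assoc: "\<lbrakk>f \<in> Hom A W X; g \<in> Hom A X Y; h \<in> Hom A Y Z\<rbrakk>
                      \<Longrightarrow> (h \<cdot> g) \<cdot> f = h \<cdot> (g \<cdot> f)"

locale preadditive_category = category +
  assumes Hom_group: "\<lbrakk>X \<in> Obj A; Y \<in> Obj A\<rbrakk> \<Longrightarrow> comm_group (hom_group A X Y)"
    and Comp_Plus: "\<lbrakk>f \<in> Hom A X Y; f' \<in> Hom A X Y; g \<in> Hom A Y Z\<rbrakk>
                     \<Longrightarrow> g \<cdot> Plus A f f' = Plus A (g \<cdot> f) (g \<cdot> f')"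
    and Plus_Comp: "\<lbrakk>f \<in> Hom A X Y; g \<in> Hom A Y Z; g' \<in> Hom A Y Z\<rbrakk>
                     \<Longrightarrow> Plus A g g' \<cdot> f = Plus A (g \<cdot> f) (g' \<cdot> f)"

definition is_zero_object :: "('o, 'm, 'x) precat_scheme \<Rightarrow> 'o \<Rightarrow> bool" where
  "is_zero_object A Z \<longleftrightarrow> Z \<in> Obj A \<and>
     (\<forall>X \<in> Obj A. (\<exists>!f. f \<in> Hom A X Z) \<and> (\<exists>!f. f \<in> Hom A Z X))"

definition is_biproduct ::
    "('o, 'm, 'x) precat_scheme \<Rightarrow> 'o \<Rightarrow> 'o \<Rightarrow> 'o \<Rightarrow> 'm \<Rightarrow> 'm \<Rightarrow> 'm \<Rightarrow> 'm \<Rightarrow> bool" where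
  "is_biproduct A X Y P i j p q \<longleftrightarrow>
     P \<in> Obj A \<and> i \<in> Hom A X P \<and> j \<in> Hom A Y P \<and> p \<in> Hom A P X \<and> q \<in> Hom A P Y \<and>
     p \<cdot>\<^bsub>A\<^esub> i = Ide A X \<and> q \<cdot>\<^bsub>A\<^esub> j = Ide A Y \<and> p \<cdot>\<^bsub>A\<^esub> j = Zero A Y X \<and> q \<cdot>\<^bsub>A\<^esub> i = Zero A X Y \<and>
     Plus A (i \<cdot>\<^bsub>A\<^esub> p) (j \<cdot>\<^bsub>A\<^esub> q) = Ide A P"

locale additive_category = preadditive_category +
  assumes ex_zero_object: "\<exists>Z. is_zero_object A Z"
    and ex_biproduct: "\<lbrakk>X \<in> Obj A; Y \<in> Obj A\<rbrakk> \<Longrightarrow> \<exists>P i j p q. is_biproduct A X Y P i j p q"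

definition is_kernel :: "('o, 'm, 'x) precat_scheme \<Rightarrow> 'm \<Rightarrow> 'm \<Rightarrow> bool" where
  "is_kernel A k f \<longleftrightarrow> k \<in> Arr A \<and> f \<in> Arr A \<and> Cod A k = Dom A f \<and>
     f \<cdot>\<^bsub>A\<^esub> k = Zero A (Dom A k) (Cod A f) \<and>
     (\<forall>h \<in> Arr A. Cod A h = Dom A f \<and> f \<cdot>\<^bsub>A\<^esub> h = Zero A (Dom A h) (Cod A f) \<longrightarrow>
        (\<exists>!u. u \<in> Hom A (Dom A h) (Dom A k) \<and> k \<cdot>\<^bsub>A\<^esub> u = h))"

definition is_cokernel :: "('o, 'm, 'x) precat_scheme \<Rightarrow> 'm \<Rightarrow> 'm \<Rightarrow> bool" where
  "is_cokernel A c f \<longleftrightarrow> c \<in> Arr A \<and> f \<in> Arr A \<and> Dom A c = Cod A f \<and>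
     c \<cdot>\<^bsub>A\<^esub> f = Zero A (Dom A f) (Cod A c) \<and>
     (\<forall>h \<in> Arr A. Dom A h = Cod A f \<and> h \<cdot>\<^bsub>A\<^esub> f = Zero A (Dom A f) (Cod A h) \<longrightarrow>
        (\<exists>!u. u \<in> Hom A (Cod A c) (Cod A h) \<and> u \<cdot>\<^bsub>A\<^esub> c = h))"

locale pre_abelian_category = additive_category +
  assumes ex_kernel: "f \<in> Arr A \<Longrightarrow> \<exists>k. is_kernel A k f"
    and ex_cokernel: "f \<in> Arr A \<Longrightarrow> \<exists>c. is_cokernel A c f"

definition is_mono :: "('o, 'm, 'x) precat_scheme \<Rightarrow> 'm \<Rightarrow> bool" where
  "is_mono A f \<longleftrightarrow> f \<in> Arr A \<and>
     (\<forall>W. \<forall>u \<in> Hom A W (Dom A f). \<forall>v \<in> Hom A W (Dom A f). f \<cdot>\<^bsub>A\<^esub> u = f \<cdot>\<^bsub>A\<^esub> v \<longrightarrow> u = v)"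

definition is_epi :: "('o, 'm, 'x) precat_scheme \<Rightarrow> 'm \<Rightarrow> bool" where
  "is_epi A f \<longleftrightarrow> f \<in> Arr A \<and>
     (\<forall>W. \<forall>u \<in> Hom A (Cod A f) W. \<forall>v \<in> Hom A (Cod A f) W. u \<cdot>\<^bsub>A\<^esub> f = v \<cdot>\<^bsub>A\<^esub> f \<longrightarrow> u = v)"

locale abelian_category = pre_abelian_category +
  assumes mono_is_kernel: "is_mono A f \<Longrightarrow> \<exists>g. is_kernel A f g"
    and epi_is_cokernel: "is_epi A f \<Longrightarrow> \<exists>g. is_cokernel A f g"

(* Full subcategories are given by their sets of objects. *)

definition full_subcat :: "('o, 'm, 'x) precat_scheme \<Rightarrow> 'o set \<Rightarrow> ('o, 'm, 'x) precat_scheme" where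
  "full_subcat A S = A\<lparr>Obj := Obj A \<inter> S, Arr := {f \<in> Arr A. Dom A f \<in> S \<and> Cod A f \<in> S}\<rparr>"

definition isomorphic :: "('o, 'm, 'x) precat_scheme \<Rightarrow> 'o \<Rightarrow> 'o \<Rightarrow> bool" where
  "isomorphic A X Y \<longleftrightarrow> (\<exists>f \<in> Hom A X Y. \<exists>g \<in> Hom A Y X. g \<cdot>\<^bsub>A\<^esub> f = Ide A X \<and> f \<cdot>\<^bsub>A\<^esub> g = Ide A Y)"

definition iso_closed :: "('o, 'm, 'x) precat_scheme \<Rightarrow> 'o set \<Rightarrow> bool" where
  "iso_closed A S \<longleftrightarrow> (\<forall>X \<in> S. \<forall>Y \<in> Obj A. isomorphic A X Y \<longrightarrow> Y \<in> S)"

definition short_exact :: "('o, 'm, 'x) precat_scheme \<Rightarrow> 'm \<Rightarrow> 'm \<Rightarrow> bool" where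
  "short_exact A f g \<longleftrightarrow> is_kernel A f g \<and> is_cokernel A g f"

definition torsion_pair :: "('o, 'm, 'x) precat_scheme \<Rightarrow> 'o set \<Rightarrow> 'o set \<Rightarrow> bool" where
  "torsion_pair B T F \<longleftrightarrow> pre_abelian_category B \<and>
     T \<subseteq> Obj B \<and> F \<subseteq> Obj B \<and> iso_closed B T \<and> iso_closed B F \<and>
     (\<forall>X \<in> T. \<forall>Y \<in> F. Hom B X Y = {Zero B X Y}) \<and>
     (\<forall>M \<in> Obj B. \<exists>X \<in> T. \<exists>Y \<in> F. \<exists>f \<in> Hom B X M. \<exists>g \<in> Hom B M Y. short_exact B f g)"

definition right_approximation :: "('o, 'm, 'x) precat_scheme \<Rightarrow> 'o set \<Rightarrow> 'o \<Rightarrow> 'm \<Rightarrow> bool" where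
  "right_approximation B S M f \<longleftrightarrow> (\<exists>X \<in> S. f \<in> Hom B X M \<and>
     (\<forall>X' \<in> S. \<forall>h \<in> Hom B X' M. \<exists>u \<in> Hom B X' X. f \<cdot>\<^bsub>B\<^esub> u = h))"

definition left_approximation :: "('o, 'm, 'x) precat_scheme \<Rightarrow> 'o set \<Rightarrow> 'o \<Rightarrow> 'm \<Rightarrow> bool" where
  "left_approximation B S M f \<longleftrightarrow> (\<exists>X \<in> S. f \<in> Hom B M X \<and>
     (\<forall>X' \<in> S. \<forall>h \<in> Hom B M X'. \<exists>u \<in> Hom B X X'. u \<cdot>\<^bsub>B\<^esub> f = h))"

definition contravariantly_finite :: "('o, 'm, 'x) precat_scheme \<Rightarrow> 'o set \<Rightarrow> bool" where
  "contravariantly_finite B S \<longleftrightarrow> (\<forall>M \<in> Obj B. \<exists>f. right_approximation B S M f)"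

definition covariantly_finite :: "('o, 'm, 'x) precat_scheme \<Rightarrow> 'o set \<Rightarrow> bool" where
  "covariantly_finite B S \<longleftrightarrow> (\<forall>M \<in> Obj B. \<exists>f. left_approximation B S M f)"

definition functorially_finite :: "('o, 'm, 'x) precat_scheme \<Rightarrow> 'o set \<Rightarrow> bool" where
  "functorially_finite B S \<longleftrightarrow> contravariantly_finite B S \<and> covariantly_finite B S"

definition ff_torsion_pair :: "('o, 'm, 'x) precat_scheme \<Rightarrow> 'o set \<Rightarrow> 'o set \<Rightarrow> bool" where
  "ff_torsion_pair B T F \<longleftrightarrow>
     torsion_pair B T F \<and> functorially_finite B T \<and> functorially_finite B F"

definition extensions :: "('o, 'm, 'x) precat_scheme \<Rightarrow> 'o set \<Rightarrow> 'o set \<Rightarrow> 'o set" where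
  "extensions A U V = {M \<in> Obj A. \<exists>M' \<in> U. \<exists>M'' \<in> V. \<exists>f \<in> Hom A M' M. \<exists>g \<in> Hom A M M''.
     short_exact A f g}"

definition projective :: "('o, 'm, 'x) precat_scheme \<Rightarrow> 'o \<Rightarrow> bool" where
  "projective A P \<longleftrightarrow> P \<in> Obj A \<and>
     (\<forall>e. is_epi A e \<longrightarrow> (\<forall>f \<in> Hom A P (Cod A e). \<exists>u \<in> Hom A P (Dom A e). e \<cdot>\<^bsub>A\<^esub> u = f))"

definition injective :: "('o, 'm, 'x) precat_scheme \<Rightarrow> 'o \<Rightarrow> bool" where
  "injective A I \<longleftrightarrow> I \<in> Obj A \<and>
     (\<forall>m. is_mono A m \<longrightarrow> (\<forall>f \<in> Hom A (Dom A m) I. \<exists>u \<in> Hom A (Cod A m) I. u \<cdot>\<^bsub>A\<^esub> m = f))"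

definition enough_projectives :: "('o, 'm, 'x) precat_scheme \<Rightarrow> bool" where
  "enough_projectives A \<longleftrightarrow> (\<forall>M \<in> Obj A. \<exists>P e. projective A P \<and> e \<in> Hom A P M \<and> is_epi A e)"

definition enough_injectives :: "('o, 'm, 'x) precat_scheme \<Rightarrow> bool" where
  "enough_injectives A \<longleftrightarrow> (\<forall>M \<in> Obj A. \<exists>I m. injective A I \<and> m \<in> Hom A M I \<and> is_mono A m)"

end

theory Submission
  imports Defs
begin

text \<open>
  Write \<open>H = C' \<inter> D\<close>. Passing to the opposite category exchanges \<open>T\<close> and \<open>F\<close> in a torsion pair
  \<open>(T, F)\<close>, kernels and cokernels, left and right approximations, and the two ends of the interval:
  \<open>(C, D), (C', D')\<close> becomes \<open>(D', C'), (D, C)\<close> with the same \<open>H\<close>. So of each dual pair of facts only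
  one has to be argued.

  The category \<open>H\<close> is pre-abelian because the \<open>C'\<close>-torsion part of a kernel formed in \<open>A\<close> is a kernel
  in \<open>H\<close> (\<open>heart_kernel\<close>). In \<open>A\<close> a pair \<open>X \<rightarrow> Y \<rightarrow> Z\<close> that is short exact in \<open>H\<close> might a priori have
  homology in the middle. Comparing kernels shows that this homology lies in \<open>D'\<close>, comparing
  cokernels that it lies in \<open>C \<subseteq> C'\<close>; hence it vanishes, and short exactness in \<open>H\<close> is short exactness
  in \<open>A\<close> (\<open>heart_short_exact\<close>).

  For a torsion pair \<open>(X, Y)\<close> in \<open>A\<close> with \<open>C \<subseteq> X \<subseteq> C'\<close>, the torsion sequence in \<open>A\<close> of an object
  of \<open>H\<close> already lies in \<open>H\<close>, since \<open>D\<close> is closed under subobjects and \<open>C'\<close> under quotients. Torsion classes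
  are always contravariantly finite. A left \<open>(X \<inter> D)\<close>-approximation arises from a left \<open>X\<close>-approximation
  followed by the projection onto its \<open>D\<close>-part (\<open>left_approximation_torsion_free_part\<close>).

  Conversely, let \<open>(T, F)\<close> be a torsion pair in \<open>H\<close>. Every \<open>M\<close> has subobjects \<open>M\<^sub>0 \<subseteq> M\<^sub>1 \<subseteq> M\<close> with
  \<open>M\<^sub>0 \<in> C\<close>, \<open>M\<^sub>1/M\<^sub>0 \<in> H\<close> and \<open>M/M\<^sub>1 \<in> D'\<close>. The preimage in \<open>M\<^sub>1\<close> of the \<open>T\<close>-part of \<open>M\<^sub>1/M\<^sub>0\<close> is an
  extension of a \<open>T\<close>-object by a \<open>C\<close>-object, and its cokernel in \<open>M\<close> is an extension of a \<open>D'\<close>-object by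
  an \<open>F\<close>-object; both are instances of the third isomorphism theorem (\<open>lifted_torsion_pair\<close>).
  Covariant finiteness of \<open>extensions A C T\<close> comes from a general fact: with enough projectives,
  extensions of covariantly finite classes form a covariantly finite class (\<open>extensions_covariantly_finite\<close>).
\<close>

section \<open>The opposite category\<close>

definition opp :: "('o, 'm, 'x) precat_scheme \<Rightarrow> ('o, 'm, 'x) precat_scheme" where
  "opp A = A\<lparr>Dom := Cod A, Cod := Dom A, Comp := (\<lambda>g f. Comp A f g), Zero := (\<lambda>X Y. Zero A Y X)\<rparr>"

lemma opp_sel [simp]:
  "Obj (opp A) = Obj A" "Arr (opp A) = Arr A" "Dom (opp A) = Cod A" "Cod (opp A) = Dom A"
  "Ide (opp A) = Ide A" "Comp (opp A) g f = Comp A f g" "Plus (opp A) = Plus A"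
  "Zero (opp A) X Y = Zero A Y X"
  by (simp_all add: opp_def)

lemma opp_opp [simp]: "opp (opp A) = A"
  by (simp add: opp_def)

lemma Hom_opp [simp]: "Hom (opp A) X Y = Hom A Y X"
  by (auto simp: Hom_def)

lemma is_kernel_opp [simp]: "is_kernel (opp A) k f \<longleftrightarrow> is_cokernel A k f"
  by (auto simp: is_kernel_def is_cokernel_def)

lemma is_cokernel_opp [simp]: "is_cokernel (opp A) c f \<longleftrightarrow> is_kernel A c f"
  by (auto simp: is_kernel_def is_cokernel_def)

lemma short_exact_opp [simp]: "short_exact (opp A) f g \<longleftrightarrow> short_exact A g f"
  by (auto simp: short_exact_def)

lemma is_mono_opp [simp]: "is_mono (opp A) f \<longleftrightarrow> is_epi A f"
  by (simp add: is_mono_def is_epi_def)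

lemma is_epi_opp [simp]: "is_epi (opp A) f \<longleftrightarrow> is_mono A f"
  by (simp add: is_mono_def is_epi_def)

lemma is_zero_object_opp [simp]: "is_zero_object (opp A) Z \<longleftrightarrow> is_zero_object A Z"
  by (auto simp: is_zero_object_def)

lemma is_biproduct_opp [simp]:
  "is_biproduct (opp A) X Y P i j p q \<longleftrightarrow> is_biproduct A X Y P p q i j"
  by (auto simp: is_biproduct_def)

lemma isomorphic_opp [simp]: "isomorphic (opp A) X Y \<longleftrightarrow> isomorphic A X Y"
  by (auto simp: isomorphic_def)

lemma iso_closed_opp [simp]: "iso_closed (opp A) S \<longleftrightarrow> iso_closed A S"
  by (simp add: iso_closed_def)

lemma full_subcat_opp [simp]: "full_subcat (opp A) S = opp (full_subcat A S)"
  by (rule precat.equality) (auto simp: opp_def full_subcat_def)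

lemma right_approximation_opp [simp]:
  "right_approximation (opp A) S M f \<longleftrightarrow> left_approximation A S M f"
  by (simp add: right_approximation_def left_approximation_def)

lemma left_approximation_opp [simp]:
  "left_approximation (opp A) S M f \<longleftrightarrow> right_approximation A S M f"
  by (simp add: right_approximation_def left_approximation_def)

lemma contravariantly_finite_opp [simp]:
  "contravariantly_finite (opp A) S \<longleftrightarrow> covariantly_finite A S"
  by (simp add: contravariantly_finite_def covariantly_finite_def)

lemma covariantly_finite_opp [simp]:
  "covariantly_finite (opp A) S \<longleftrightarrow> contravariantly_finite A S"
  by (simp add: contravariantly_finite_def covariantly_finite_def)

lemma functorially_finite_opp [simp]: "functorially_finite (opp A) S \<longleftrightarrow> functorially_finite A S"
  by (auto simp: functorially_finite_def)

lemma extensions_opp [simp]: "extensions (opp A) U V = extensions A V U"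
  by (auto simp: extensions_def)

lemma projective_opp [simp]: "projective (opp A) P \<longleftrightarrow> injective A P"
  by (simp add: projective_def injective_def)

lemma enough_projectives_opp [simp]: "enough_projectives (opp A) \<longleftrightarrow> enough_injectives A"
  by (simp add: enough_projectives_def enough_injectives_def)

lemma hom_group_opp [simp]: "hom_group (opp A) X Y = hom_group A Y X"
  by (simp add: hom_group_def)

text \<open>Rewriting with these turns a fact about \<open>opp A\<close> into the dual fact about \<open>A\<close>. Half of the lemmas
  below are obtained by applying another lemma to \<open>opp A\<close> and rewriting.\<close>
lemmas opp_simps =
  opp_sel opp_opp Hom_opp is_kernel_opp is_cokernel_opp short_exact_opp is_mono_opp is_epi_opp
  is_zero_object_opp is_biproduct_opp isomorphic_opp iso_closed_opp full_subcat_opp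
  right_approximation_opp left_approximation_opp contravariantly_finite_opp covariantly_finite_opp
  functorially_finite_opp extensions_opp projective_opp enough_projectives_opp hom_group_opp

lemma category_opp:
  assumes "category A" shows "category (opp A)"
proof -
  interpret category A by fact
  show ?thesis
    by unfold_locales (auto simp: Dom_Obj Cod_Obj Ide_Hom intro: Comp_Hom Comp_Ide Ide_Comp Comp_assoc[symmetric])
qed

lemma preadditive_opp:
  assumes "preadditive_category A" shows "preadditive_category (opp A)"
proof -
  interpret preadditive_category A by fact
  show ?thesis
    by (intro preadditive_category.intro preadditive_category_axioms.intro category_opp category_axioms)
      (auto intro: Hom_group Comp_Plus Plus_Comp)
qed

lemma additive_opp:
  assumes "additive_category A" shows "additive_category (opp A)"
proof -
  interpret additive_category A by fact
  show ?thesis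
  proof (intro additive_category.intro additive_category_axioms.intro preadditive_opp
      preadditive_category_axioms)
    show "\<exists>P i j p q. is_biproduct (opp A) X Y P i j p q" if "X \<in> Obj (opp A)" "Y \<in> Obj (opp A)" for X Y
      using ex_biproduct[of X Y] that by simp blast
  qed (simp add: ex_zero_object)
qed

lemma pre_abelian_opp:
  assumes "pre_abelian_category A" shows "pre_abelian_category (opp A)"
proof -
  interpret pre_abelian_category A by fact
  show ?thesis
    by (intro pre_abelian_category.intro pre_abelian_category_axioms.intro additive_opp
        additive_category_axioms) (auto intro: ex_kernel ex_cokernel)
qed

lemma abelian_opp:
  assumes "abelian_category A" shows "abelian_category (opp A)"
proof -
  interpret abelian_category A by fact
  show ?thesis
    by (intro abelian_category.intro abelian_category_axioms.intro pre_abelian_opp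
        pre_abelian_category_axioms) (auto intro: mono_is_kernel epi_is_cokernel)
qed

lemma pre_abelian_opp_iff: "pre_abelian_category (opp A) \<longleftrightarrow> pre_abelian_category A"
  using pre_abelian_opp[of A] pre_abelian_opp[of "opp A"] by auto

lemma torsion_pair_opp [simp]: "torsion_pair (opp A) F T \<longleftrightarrow> torsion_pair A T F"
  unfolding torsion_pair_def pre_abelian_opp_iff Hom_opp short_exact_opp iso_closed_opp opp_sel
  by blast

section \<open>Kernels, cokernels and zero morphisms\<close>

lemma HomD:
  assumes "f \<in> Hom A X Y"
  shows "f \<in> Arr A" "Dom A f = X" "Cod A f = Y"
  using assms by (auto simp: Hom_def)

context preadditive_category
begin

lemma Hom_Obj:
  assumes "f \<in> Hom A X Y" shows "X \<in> Obj A" "Y \<in> Obj A"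
  using assms Dom_Obj Cod_Obj by (auto simp: Hom_def)

lemma Zero_Hom: "\<lbrakk>X \<in> Obj A; Y \<in> Obj A\<rbrakk> \<Longrightarrow> Zero A X Y \<in> Hom A X Y"
  using monoid.one_closed[of "hom_group A X Y"] Hom_group[of X Y]
  by (simp add: hom_group_def comm_group_def group_def)

lemma Plus_Hom:
  assumes "f \<in> Hom A X Y" "g \<in> Hom A X Y" shows "Plus A f g \<in> Hom A X Y"
proof -
  interpret G: comm_group "hom_group A X Y" using Hom_group Hom_Obj[OF assms(1)] by blast
  show ?thesis using G.m_closed assms by (simp add: hom_group_def)
qed

lemma Plus_Zero:
  assumes "f \<in> Hom A X Y"
  shows "Plus A f (Zero A X Y) = f" "Plus A (Zero A X Y) f = f"
proof -
  interpret G: comm_group "hom_group A X Y" using Hom_group Hom_Obj[OF assms(1)] by blast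
  show "Plus A f (Zero A X Y) = f" "Plus A (Zero A X Y) f = f"
    using G.r_one G.l_one assms by (simp_all add: hom_group_def)
qed

lemma Plus_idem:
  assumes "f \<in> Hom A X Y" "Plus A f f = f" shows "f = Zero A X Y"
proof -
  interpret G: comm_group "hom_group A X Y" using Hom_group Hom_Obj[OF assms(1)] by blast
  show ?thesis using G.r_cancel_one'[of f f] assms by (auto simp: hom_group_def)
qed

lemma Plus_right_cancel:
  assumes "f \<in> Hom A X Y" "g \<in> Hom A X Y" "h \<in> Hom A X Y" "Plus A f h = Plus A g h"
  shows "f = g"
proof -
  interpret G: comm_group "hom_group A X Y" using Hom_group Hom_Obj[OF assms(1)] by blast
  show ?thesis using G.right_cancel[of h f g] assms by (simp add: hom_group_def)
qed

lemma ex_negative: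
  assumes "f \<in> Hom A X Y"
  obtains f' where "f' \<in> Hom A X Y" "Plus A f f' = Zero A X Y"
proof -
  interpret G: comm_group "hom_group A X Y" using Hom_group Hom_Obj[OF assms(1)] by blast
  have f: "f \<in> carrier (hom_group A X Y)" using assms by (simp add: hom_group_def)
  show thesis using that[of "m_inv (hom_group A X Y) f"] G.inv_closed[OF f] G.r_inv[OF f]
    by (simp add: hom_group_def)
qed

lemma Comp_Zero:
  assumes "g \<in> Hom A Y Z" "X \<in> Obj A"
  shows "g \<cdot> Zero A X Y = Zero A X Z"
proof -
  have z: "Zero A X Y \<in> Hom A X Y" using assms Hom_Obj Zero_Hom by blast
  have "Plus A (g \<cdot> Zero A X Y) (g \<cdot> Zero A X Y) = g \<cdot> Zero A X Y"
    using Comp_Plus[OF z z assms(1)] Plus_Zero[OF z] by simp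
  then show ?thesis using Plus_idem Comp_Hom[OF z assms(1)] by blast
qed

lemma Zero_Comp:
  assumes "f \<in> Hom A X Y" "Z \<in> Obj A"
  shows "Zero A Y Z \<cdot> f = Zero A X Z"
proof -
  have z: "Zero A Y Z \<in> Hom A Y Z" using assms Hom_Obj Zero_Hom by blast
  have "Plus A (Zero A Y Z \<cdot> f) (Zero A Y Z \<cdot> f) = Zero A Y Z \<cdot> f"
    using Plus_Comp[OF assms(1) z z] Plus_Zero[OF z] by simp
  then show ?thesis using Plus_idem Comp_Hom[OF assms(1) z] by blast
qed

lemma mono_cancel:
  assumes "is_mono A f" "f \<in> Hom A X Y" "u \<in> Hom A W X" "v \<in> Hom A W X" "f \<cdot> u = f \<cdot> v"
  shows "u = v"
  using assms unfolding is_mono_def by (auto simp: Hom_def)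

lemma epi_cancel:
  assumes "is_epi A f" "f \<in> Hom A X Y" "u \<in> Hom A Y W" "v \<in> Hom A Y W" "u \<cdot> f = v \<cdot> f"
  shows "u = v"
  using assms unfolding is_epi_def by (auto simp: Hom_def)

lemma monoI:
  assumes "f \<in> Hom A X Y"
    and "\<And>W u v. \<lbrakk>u \<in> Hom A W X; v \<in> Hom A W X; f \<cdot> u = f \<cdot> v\<rbrakk> \<Longrightarrow> u = v"
  shows "is_mono A f"
  using assms unfolding is_mono_def by (auto simp: Hom_def)

lemma epiI:
  assumes "f \<in> Hom A X Y"
    and "\<And>W u v. \<lbrakk>u \<in> Hom A Y W; v \<in> Hom A Y W; u \<cdot> f = v \<cdot> f\<rbrakk> \<Longrightarrow> u = v"
  shows "is_epi A f"
  using assms unfolding is_epi_def by (auto simp: Hom_def)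

lemma Ide_mono: "X \<in> Obj A \<Longrightarrow> is_mono A (Ide A X)"
  using Ide_Comp by (intro monoI[OF Ide_Hom]) auto

lemma mono_reflects_Zero:
  assumes "is_mono A f" "f \<in> Hom A X Y" "u \<in> Hom A W X" "f \<cdot> u = Zero A W Y"
  shows "u = Zero A W X"
  using mono_cancel[OF assms(1,2,3)] assms Zero_Hom Comp_Zero Hom_Obj by metis

lemma epi_reflects_Zero:
  assumes "is_epi A f" "f \<in> Hom A X Y" "u \<in> Hom A Y W" "u \<cdot> f = Zero A X W"
  shows "u = Zero A Y W"
  using epi_cancel[OF assms(1,2,3)] assms Zero_Hom Zero_Comp Hom_Obj by metis

lemma mono_from_Zero:
  assumes f: "f \<in> Hom A X Y"
    and "\<And>W u. \<lbrakk>u \<in> Hom A W X; f \<cdot> u = Zero A W Y\<rbrakk> \<Longrightarrow> u = Zero A W X"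
  shows "is_mono A f"
proof (rule monoI[OF f])
  fix W u v assume u: "u \<in> Hom A W X" and v: "v \<in> Hom A W X" and eq: "f \<cdot> u = f \<cdot> v"
  obtain v' where v': "v' \<in> Hom A W X" "Plus A v v' = Zero A W X"
    using ex_negative[OF v] by blast
  have "f \<cdot> Plus A u v' = f \<cdot> Plus A v v'"
    using Comp_Plus[OF u v'(1) f] Comp_Plus[OF v v'(1) f] eq by simp
  also have "\<dots> = Zero A W Y" using v'(2) Comp_Zero[OF f] Hom_Obj[OF u] by simp
  finally have "Plus A u v' = Plus A v v'" using assms(2) Plus_Hom[OF u v'(1)] v'(2) by metis
  then show "u = v" using Plus_right_cancel[OF u v v'(1)] by blast
qed

text \<open>Kernels are handled through typed Hom-sets, with uniqueness of factorisations repackaged as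
  \<open>is_mono\<close>; this form also applies verbatim to full subcategories.\<close>
lemma kernelI:
  assumes k: "k \<in> Hom A X Y" and f: "f \<in> Hom A Y Z" and "f \<cdot> k = Zero A X Z" and "is_mono A k"
    and ex: "\<And>W h. \<lbrakk>h \<in> Hom A W Y; f \<cdot> h = Zero A W Z\<rbrakk> \<Longrightarrow> \<exists>u \<in> Hom A W X. k \<cdot> u = h"
  shows "is_kernel A k f"
  unfolding is_kernel_def
proof (intro conjI ballI impI)
  fix h assume h: "h \<in> Arr A" and *: "Cod A h = Dom A f \<and> f \<cdot> h = Zero A (Dom A h) (Cod A f)"
  have "h \<in> Hom A (Dom A h) Y" using h * f by (simp add: Hom_def)
  then obtain u where u: "u \<in> Hom A (Dom A h) X" "k \<cdot> u = h" using ex * f by (auto simp: Hom_def)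
  show "\<exists>!u. u \<in> Hom A (Dom A h) (Dom A k) \<and> k \<cdot> u = h"
    unfolding HomD(2)[OF k]
  proof (intro ex1I[of _ u] conjI)
    show "v = u" if "v \<in> Hom A (Dom A h) X \<and> k \<cdot> v = h" for v
      using mono_cancel[OF \<open>is_mono A k\<close> k] that u by blast
  qed (use u in auto)
qed (use assms in \<open>auto simp: Hom_def\<close>)

lemma kernelD:
  assumes "is_kernel A k f" and k: "k \<in> Hom A X Y" and f: "f \<in> Hom A Y Z"
  shows kernel_zero: "f \<cdot> k = Zero A X Z"
    and kernel_mono: "is_mono A k"
    and kernel_factor: "\<And>W h. \<lbrakk>h \<in> Hom A W Y; f \<cdot> h = Zero A W Z\<rbrakk> \<Longrightarrow> \<exists>u \<in> Hom A W X. k \<cdot> u = h"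
proof -
  show z: "f \<cdot> k = Zero A X Z" using assms by (auto simp: is_kernel_def Hom_def)
  have un: "\<exists>!u. u \<in> Hom A W X \<and> k \<cdot> u = h" if "h \<in> Hom A W Y" "f \<cdot> h = Zero A W Z" for W h
  proof -
    have "h \<in> Arr A" "Cod A h = Dom A f" "Dom A h = W" "Dom A k = X" "Cod A f = Z"
      using that(1) k f by (auto simp: Hom_def)
    then show ?thesis using assms(1) that(2) unfolding is_kernel_def by metis
  qed
  then show "\<And>W h. \<lbrakk>h \<in> Hom A W Y; f \<cdot> h = Zero A W Z\<rbrakk> \<Longrightarrow> \<exists>u \<in> Hom A W X. k \<cdot> u = h" by blast
  show "is_mono A k"
  proof (rule monoI[OF k])
    fix W u v assume u: "u \<in> Hom A W X" and v: "v \<in> Hom A W X" and eq: "k \<cdot> u = k \<cdot> v"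
    have "f \<cdot> (k \<cdot> u) = Zero A W Z"
      using Comp_assoc[OF u k f] z Zero_Comp[OF u] Hom_Obj[OF f] by simp
    then show "u = v" using un[OF Comp_Hom[OF u k]] u v eq by metis
  qed
qed

lemmas preadditive_category_opp = preadditive_opp[OF preadditive_category_axioms]

lemma cokernelI:
  assumes "f \<in> Hom A X Y" and "c \<in> Hom A Y Z" and "c \<cdot> f = Zero A X Z" and "is_epi A c"
    and "\<And>W h. \<lbrakk>h \<in> Hom A Y W; h \<cdot> f = Zero A X W\<rbrakk> \<Longrightarrow> \<exists>u \<in> Hom A Z W. u \<cdot> c = h"
  shows "is_cokernel A c f"
  using preadditive_category.kernelI[OF preadditive_category_opp, unfolded opp_simps] assms by blast

lemma cokernelD:
  assumes "is_cokernel A c f" and "f \<in> Hom A X Y" and "c \<in> Hom A Y Z"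
  shows cokernel_zero: "c \<cdot> f = Zero A X Z"
    and cokernel_epi: "is_epi A c"
    and cokernel_factor:
      "\<And>W h. \<lbrakk>h \<in> Hom A Y W; h \<cdot> f = Zero A X W\<rbrakk> \<Longrightarrow> \<exists>u \<in> Hom A Z W. u \<cdot> c = h"
  using preadditive_category.kernelD[OF preadditive_category_opp, unfolded opp_simps] assms by blast+

lemma mono_Comp:
  assumes "is_mono A f" "is_mono A g" "f \<in> Hom A X Y" "g \<in> Hom A Y Z"
  shows "is_mono A (g \<cdot> f)"
proof (rule monoI)
  show "g \<cdot> f \<in> Hom A X Z" using assms Comp_Hom by blast
  fix W u v assume u: "u \<in> Hom A W X" and v: "v \<in> Hom A W X" and eq: "g \<cdot> f \<cdot> u = g \<cdot> f \<cdot> v"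
  have "g \<cdot> (f \<cdot> u) = g \<cdot> (f \<cdot> v)"
    using eq Comp_assoc[OF u assms(3,4)] Comp_assoc[OF v assms(3,4)] by simp
  then have "f \<cdot> u = f \<cdot> v"
    using mono_cancel[OF assms(2,4) Comp_Hom[OF u assms(3)] Comp_Hom[OF v assms(3)]] by blast
  then show "u = v" using mono_cancel[OF assms(1,3) u v] by blast
qed

lemma mono_first_factor:
  assumes "is_mono A (g \<cdot> f)" "f \<in> Hom A X Y" "g \<in> Hom A Y Z"
  shows "is_mono A f"
proof (rule monoI[OF assms(2)])
  fix W u v assume *: "u \<in> Hom A W X" "v \<in> Hom A W X" "f \<cdot> u = f \<cdot> v"
  have "g \<cdot> f \<cdot> u = g \<cdot> f \<cdot> v"
    using * Comp_assoc[OF *(1) assms(2,3)] Comp_assoc[OF *(2) assms(2,3)] by simp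
  then show "u = v" using mono_cancel[OF assms(1) Comp_Hom[OF assms(2,3)]] * by blast
qed

lemma epi_Comp:
  assumes "is_epi A f" "is_epi A g" "f \<in> Hom A X Y" "g \<in> Hom A Y Z"
  shows "is_epi A (g \<cdot> f)"
  using preadditive_category.mono_Comp[OF preadditive_category_opp, unfolded opp_simps] assms by blast

lemma epi_second_factor:
  assumes "is_epi A (g \<cdot> f)" "f \<in> Hom A X Y" "g \<in> Hom A Y Z"
  shows "is_epi A g"
  using preadditive_category.mono_first_factor[OF preadditive_category_opp, unfolded opp_simps] assms
  by blast

section \<open>Biproducts and pushouts\<close>

lemma biproductD:
  assumes "is_biproduct A X Y P i j p q"
  shows "i \<in> Hom A X P" "j \<in> Hom A Y P" "p \<in> Hom A P X" "q \<in> Hom A P Y"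
    "p \<cdot> i = Ide A X" "q \<cdot> j = Ide A Y" "p \<cdot> j = Zero A Y X" "q \<cdot> i = Zero A X Y"
    "Plus A (i \<cdot> p) (j \<cdot> q) = Ide A P" "P \<in> Obj A"
  using assms by (auto simp: is_biproduct_def)

lemma biproduct_copair:
  assumes bp: "is_biproduct A X Y P i j p q" and x: "x \<in> Hom A X W" and y: "y \<in> Hom A Y W"
  obtains h where "h \<in> Hom A P W" "h \<cdot> i = x" "h \<cdot> j = y"
proof
  note b = biproductD[OF bp]
  have xp: "x \<cdot> p \<in> Hom A P W" and yq: "y \<cdot> q \<in> Hom A P W" using Comp_Hom b x y by blast+
  show "Plus A (x \<cdot> p) (y \<cdot> q) \<in> Hom A P W" using Plus_Hom xp yq by blast
  have "x \<cdot> p \<cdot> i = x" "y \<cdot> q \<cdot> i = Zero A X W"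
    using Comp_assoc[OF b(1,3) x] Comp_assoc[OF b(1,4) y] b Comp_Ide[OF x] Comp_Zero[OF y] Hom_Obj[OF x]
    by simp_all
  then show "Plus A (x \<cdot> p) (y \<cdot> q) \<cdot> i = x"
    using Plus_Comp[OF b(1) xp yq] Plus_Zero[OF x] by simp
  have "x \<cdot> p \<cdot> j = Zero A Y W" "y \<cdot> q \<cdot> j = y"
    using Comp_assoc[OF b(2,3) x] Comp_assoc[OF b(2,4) y] b Comp_Ide[OF y] Comp_Zero[OF x] Hom_Obj[OF y]
    by simp_all
  then show "Plus A (x \<cdot> p) (y \<cdot> q) \<cdot> j = y"
    using Plus_Comp[OF b(2) xp yq] Plus_Zero[OF y] by simp
qed

lemma biproduct_hom_eq:
  assumes bp: "is_biproduct A X Y P i j p q" and h: "h \<in> Hom A P W" and h': "h' \<in> Hom A P W"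
    and eq: "h \<cdot> i = h' \<cdot> i" "h \<cdot> j = h' \<cdot> j"
  shows "h = h'"
proof -
  note b = biproductD[OF bp]
  have *: "f = Plus A (f \<cdot> i \<cdot> p) (f \<cdot> j \<cdot> q)" if f: "f \<in> Hom A P W" for f
    using Comp_Plus[OF Comp_Hom[OF b(3,1)] Comp_Hom[OF b(4,2)] f] b(9) Comp_Ide[OF f]
      Comp_assoc[OF b(3,1) f] Comp_assoc[OF b(4,2) f] by simp
  show ?thesis using *[OF h] *[OF h'] eq by simp
qed

end

definition is_pushout ::
    "('o, 'm, 'x) precat_scheme \<Rightarrow> 'o \<Rightarrow> 'o \<Rightarrow> 'o \<Rightarrow> 'o \<Rightarrow> 'm \<Rightarrow> 'm \<Rightarrow> 'm \<Rightarrow> 'm \<Rightarrow> bool" where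
  "is_pushout A K X Y E k l a b \<longleftrightarrow>
     k \<in> Hom A K X \<and> l \<in> Hom A K Y \<and> a \<in> Hom A X E \<and> b \<in> Hom A Y E \<and>
     a \<cdot>\<^bsub>A\<^esub> k = b \<cdot>\<^bsub>A\<^esub> l \<and>
     (\<forall>W. \<forall>x \<in> Hom A X W. \<forall>y \<in> Hom A Y W. x \<cdot>\<^bsub>A\<^esub> k = y \<cdot>\<^bsub>A\<^esub> l \<longrightarrow>
        (\<exists>!u. u \<in> Hom A E W \<and> u \<cdot>\<^bsub>A\<^esub> a = x \<and> u \<cdot>\<^bsub>A\<^esub> b = y))"

context preadditive_category
begin

lemma pushoutD:
  assumes "is_pushout A K X Y E k l a b"
  shows "k \<in> Hom A K X" "l \<in> Hom A K Y" "a \<in> Hom A X E" "b \<in> Hom A Y E" "a \<cdot> k = b \<cdot> l"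
    and pushout_factor: "\<And>W x y. \<lbrakk>x \<in> Hom A X W; y \<in> Hom A Y W; x \<cdot> k = y \<cdot> l\<rbrakk> \<Longrightarrow>
      \<exists>u \<in> Hom A E W. u \<cdot> a = x \<and> u \<cdot> b = y"
    and pushout_hom_eq: "\<And>W u v. \<lbrakk>u \<in> Hom A E W; v \<in> Hom A E W; u \<cdot> a = v \<cdot> a; u \<cdot> b = v \<cdot> b\<rbrakk> \<Longrightarrow> u = v"
proof -
  note d = assms[unfolded is_pushout_def]
  show k: "k \<in> Hom A K X" and l: "l \<in> Hom A K Y" and a: "a \<in> Hom A X E" and b: "b \<in> Hom A Y E"
    and ab: "a \<cdot> k = b \<cdot> l"
    using d by blast+
  have un: "\<exists>!u. u \<in> Hom A E W \<and> u \<cdot> a = x \<and> u \<cdot> b = y"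
    if "x \<in> Hom A X W" "y \<in> Hom A Y W" "x \<cdot> k = y \<cdot> l" for W x y
    using d that by blast
  then show "\<And>W x y. \<lbrakk>x \<in> Hom A X W; y \<in> Hom A Y W; x \<cdot> k = y \<cdot> l\<rbrakk> \<Longrightarrow>
      \<exists>u \<in> Hom A E W. u \<cdot> a = x \<and> u \<cdot> b = y" by blast
  fix W u v assume u: "u \<in> Hom A E W" and v: "v \<in> Hom A E W" and eq: "u \<cdot> a = v \<cdot> a" "u \<cdot> b = v \<cdot> b"
  have "u \<cdot> a \<cdot> k = u \<cdot> b \<cdot> l" using Comp_assoc[OF k a u] Comp_assoc[OF l b u] ab by simp
  then show "u = v" using un[OF Comp_Hom[OF a u] Comp_Hom[OF b u]] u v eq by metis
qed

text \<open>A pushout has the same cokernels on opposite sides: a map out of \<open>E\<close> that kills \<open>b\<close> amounts to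
  a map out of \<open>X\<close> that kills \<open>k\<close>.\<close>
lemma pushout_cokernel:
  assumes po: "is_pushout A K X Y E k l a b" and e: "e \<in> Hom A X Q" and ck: "is_cokernel A e k"
  obtains g where "g \<in> Hom A E Q" "g \<cdot> a = e" "is_cokernel A g b"
proof -
  note d = pushoutD[OF po]
  note ke = cokernelD[OF ck d(1) e]
  note obj = Hom_Obj[OF d(1)] Hom_Obj[OF d(2)] Hom_Obj[OF e]
  have "e \<cdot> k = Zero A Y Q \<cdot> l" using ke(1) Zero_Comp[OF d(2)] obj by simp
  then obtain g where g: "g \<in> Hom A E Q" "g \<cdot> a = e" "g \<cdot> b = Zero A Y Q"
    using d(6)[OF e Zero_Hom] obj by metis
  have "is_cokernel A g b"
  proof (rule cokernelI[OF d(4) g(1,3)])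
    show "is_epi A g" by (rule epi_second_factor[OF _ d(3) g(1)]) (simp add: g(2) ke)
    fix W h assume h: "h \<in> Hom A E W" "h \<cdot> b = Zero A Y W"
    have "h \<cdot> a \<cdot> k = h \<cdot> b \<cdot> l" using Comp_assoc[OF d(1,3) h(1)] Comp_assoc[OF d(2,4) h(1)] d(5) by simp
    also have "\<dots> = Zero A K W" using h Zero_Comp[OF d(2)] Hom_Obj by simp
    finally obtain v where v: "v \<in> Hom A Q W" "v \<cdot> e = h \<cdot> a" using ke(3) Comp_Hom d h by blast
    have "v \<cdot> g \<cdot> a = h \<cdot> a" using v Comp_assoc[OF d(3) g(1) v(1)] g(2) by simp
    moreover have "v \<cdot> g \<cdot> b = h \<cdot> b"
      using h Comp_assoc[OF d(4) g(1) v(1)] g(3) Comp_Zero[OF v(1)] obj by simp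
    ultimately have "v \<cdot> g = h" using d(7) h v g Comp_Hom by metis
    then show "\<exists>v \<in> Hom A Q W. v \<cdot> g = h" using v by blast
  qed
  then show thesis using that g by blast
qed

text \<open>With \<open>l'\<close> the negative of \<open>l\<close>, the map \<open>i k + j l'\<close> is the difference whose cokernel is the pushout
  of \<open>k\<close> and \<open>l\<close>.\<close>
lemma pushout_relation:
  assumes bp: "is_biproduct A X Y P i j p q"
    and k: "k \<in> Hom A K X" and l: "l \<in> Hom A K Y" and l': "l' \<in> Hom A K Y" "Plus A l l' = Zero A K Y"
    and h: "h \<in> Hom A P W"
  shows "h \<cdot> Plus A (i \<cdot> k) (j \<cdot> l') = Zero A K W \<longleftrightarrow> h \<cdot> i \<cdot> k = h \<cdot> j \<cdot> l"
proof -
  note b = biproductD[OF bp]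
  have t: "h \<cdot> i \<cdot> k \<in> Hom A K W" "h \<cdot> j \<cdot> l \<in> Hom A K W" "h \<cdot> j \<cdot> l' \<in> Hom A K W"
    using Comp_Hom b k l l' h by blast+
  have 1: "h \<cdot> Plus A (i \<cdot> k) (j \<cdot> l') = Plus A (h \<cdot> i \<cdot> k) (h \<cdot> j \<cdot> l')"
    using Comp_Plus[OF Comp_Hom[OF k b(1)] Comp_Hom[OF l'(1) b(2)] h] Comp_assoc[OF k b(1) h]
      Comp_assoc[OF l'(1) b(2) h] by simp
  have 2: "Plus A (h \<cdot> j \<cdot> l) (h \<cdot> j \<cdot> l') = Zero A K W"
    using Comp_Plus[OF l l'(1) Comp_Hom[OF b(2) h]] l' Comp_Zero[OF Comp_Hom[OF b(2) h]] Hom_Obj[OF k]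
    by simp
  show ?thesis unfolding 1 using 2 Plus_right_cancel[OF t] by auto
qed

lemma cokernel_imp_pushout:
  assumes bp: "is_biproduct A X Y P i j p q"
    and k: "k \<in> Hom A K X" and l: "l \<in> Hom A K Y" and l': "l' \<in> Hom A K Y" "Plus A l l' = Zero A K Y"
    and r: "r \<in> Hom A P E" and ck: "is_cokernel A r (Plus A (i \<cdot> k) (j \<cdot> l'))"
  shows "is_pushout A K X Y E k l (r \<cdot> i) (r \<cdot> j)"
proof -
  note b = biproductD[OF bp]
  have m: "Plus A (i \<cdot> k) (j \<cdot> l') \<in> Hom A K P"
    using Plus_Hom[OF Comp_Hom[OF k b(1)] Comp_Hom[OF l'(1) b(2)]] .
  note c = cokernelD[OF ck m r]
  note rel = pushout_relation[OF bp k l l']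
  have "\<exists>!u. u \<in> Hom A E W \<and> u \<cdot> (r \<cdot> i) = x \<and> u \<cdot> (r \<cdot> j) = y"
    if x: "x \<in> Hom A X W" and y: "y \<in> Hom A Y W" and eq: "x \<cdot> k = y \<cdot> l" for W x y
  proof -
    obtain h where h: "h \<in> Hom A P W" "h \<cdot> i = x" "h \<cdot> j = y" using biproduct_copair[OF bp x y] .
    then obtain u where u: "u \<in> Hom A E W" "u \<cdot> r = h" using c(3)[OF h(1)] rel[OF h(1)] eq by blast
    show ?thesis
    proof (intro ex1I[of _ u])
      show "u \<in> Hom A E W \<and> u \<cdot> (r \<cdot> i) = x \<and> u \<cdot> (r \<cdot> j) = y"
        using u h Comp_assoc[OF b(1) r u(1)] Comp_assoc[OF b(2) r u(1)] by simp
      fix v assume v: "v \<in> Hom A E W \<and> v \<cdot> (r \<cdot> i) = x \<and> v \<cdot> (r \<cdot> j) = y"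
      then have "v \<cdot> r = h"
        using biproduct_hom_eq[OF bp Comp_Hom[OF r] h(1)] h Comp_assoc[OF b(1) r] Comp_assoc[OF b(2) r]
        by metis
      then show "v = u" using epi_cancel[OF c(2) r] u v by blast
    qed
  qed
  moreover have "r \<cdot> i \<cdot> k = r \<cdot> j \<cdot> l" using rel[OF r] c(1) by blast
  ultimately show ?thesis
    unfolding is_pushout_def by (intro conjI allI ballI impI k l Comp_Hom[OF b(1) r] Comp_Hom[OF b(2) r])
qed

lemma pushout_imp_cokernel:
  assumes bp: "is_biproduct A X Y P i j p q" and po: "is_pushout A K X Y E k l a b"
    and l': "l' \<in> Hom A K Y" "Plus A l l' = Zero A K Y"
    and r: "r \<in> Hom A P E" "r \<cdot> i = a" "r \<cdot> j = b"
  shows "is_cokernel A r (Plus A (i \<cdot> k) (j \<cdot> l'))"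
proof -
  note b = biproductD[OF bp]
  note d = pushoutD[OF po]
  have m: "Plus A (i \<cdot> k) (j \<cdot> l') \<in> Hom A K P"
    using Plus_Hom[OF Comp_Hom[OF d(1) b(1)] Comp_Hom[OF l'(1) b(2)]] .
  note rel = pushout_relation[OF bp d(1,2) l']
  show ?thesis
  proof (rule cokernelI[OF m r(1)])
    show "r \<cdot> Plus A (i \<cdot> k) (j \<cdot> l') = Zero A K E" using rel[OF r(1)] r d by simp
    show "is_epi A r"
    proof (rule epiI[OF r(1)])
      fix W u v assume u: "u \<in> Hom A E W" and v: "v \<in> Hom A E W" and eq: "u \<cdot> r = v \<cdot> r"
      then have "u \<cdot> a = v \<cdot> a" "u \<cdot> b = v \<cdot> b" using r Comp_assoc[OF b(1) r(1)] Comp_assoc[OF b(2) r(1)] by metis+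
      then show "u = v" using d(7) u v by blast
    qed
    fix W h assume h: "h \<in> Hom A P W" "h \<cdot> Plus A (i \<cdot> k) (j \<cdot> l') = Zero A K W"
    then obtain u where u: "u \<in> Hom A E W" "u \<cdot> a = h \<cdot> i" "u \<cdot> b = h \<cdot> j"
      using rel[OF h(1)] d(6)[OF Comp_Hom[OF b(1) h(1)] Comp_Hom[OF b(2) h(1)]] by blast
    then have "u \<cdot> r = h" using biproduct_hom_eq[OF bp Comp_Hom[OF r(1) u(1)] h(1)] r
        Comp_assoc[OF b(1) r(1) u(1)] Comp_assoc[OF b(2) r(1) u(1)] by metis
    then show "\<exists>u \<in> Hom A E W. u \<cdot> r = h" using u by blast
  qed
qed

end

context pre_abelian_category
begin

lemma obtain_kernel:
  assumes "f \<in> Hom A X Y" obtains K k where "k \<in> Hom A K X" "is_kernel A k f"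
proof -
  obtain k where k: "is_kernel A k f" using ex_kernel HomD(1)[OF assms] by blast
  then have "k \<in> Hom A (Dom A k) X" using HomD(2)[OF assms] by (simp add: is_kernel_def Hom_def)
  then show thesis using that k by blast
qed

lemma obtain_cokernel:
  assumes "f \<in> Hom A X Y" obtains Q c where "c \<in> Hom A Y Q" "is_cokernel A c f"
proof -
  obtain c where c: "is_cokernel A c f" using ex_cokernel HomD(1)[OF assms] by blast
  then have "c \<in> Hom A Y (Cod A c)" using HomD(3)[OF assms] by (simp add: is_cokernel_def Hom_def)
  then show thesis using that c by blast
qed

lemma obtain_pushout:
  assumes k: "k \<in> Hom A K X" and l: "l \<in> Hom A K Y"
  obtains E a b where "is_pushout A K X Y E k l a b"
proof -
  obtain P i j p q where bp: "is_biproduct A X Y P i j p q"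
    using ex_biproduct Hom_Obj k l by metis
  obtain l' where l': "l' \<in> Hom A K Y" "Plus A l l' = Zero A K Y" using ex_negative[OF l] .
  have "Plus A (i \<cdot> k) (j \<cdot> l') \<in> Hom A K P" using Plus_Hom Comp_Hom biproductD[OF bp] k l' by blast
  then obtain E r where "r \<in> Hom A P E" "is_cokernel A r (Plus A (i \<cdot> k) (j \<cdot> l'))"
    by (rule obtain_cokernel)
  then show thesis using cokernel_imp_pushout[OF bp k l l'] that by blast
qed

end

section \<open>Exactness in abelian categories\<close>

context abelian_category
begin

text \<open>A monomorphism is a kernel of some \<open>g\<close>. As \<open>g\<close> factors through the cokernel of \<open>m\<close>, everything
  killed by that cokernel is killed by \<open>g\<close>.\<close>
lemma mono_cokernel_exact:
  assumes m: "m \<in> Hom A X Y" and c: "c \<in> Hom A Y Z" and mono: "is_mono A m" and ck: "is_cokernel A c m"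
  shows "short_exact A m c"
proof -
  note c' = cokernelD[OF ck m c]
  obtain g where g: "is_kernel A m g" using mono_is_kernel mono by blast
  define W where "W = Cod A g"
  have gW: "g \<in> Hom A Y W" using g HomD(3)[OF m] by (simp add: is_kernel_def Hom_def W_def)
  note k = kernelD[OF g m gW]
  obtain g' where g': "g' \<in> Hom A Z W" "g' \<cdot> c = g" using c'(3)[OF gW k(1)] by blast
  have "is_kernel A m c"
  proof (rule kernelI[OF m c c'(1) mono])
    fix V h assume h: "h \<in> Hom A V Y" "c \<cdot> h = Zero A V Z"
    have "g \<cdot> h = Zero A V W" using Comp_assoc[OF h(1) c g'(1)] g' h Comp_Zero[OF g'(1)] Hom_Obj by metis
    then show "\<exists>u \<in> Hom A V X. m \<cdot> u = h" using k(3) h by blast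
  qed
  then show ?thesis using ck by (simp add: short_exact_def)
qed

lemmas abelian_category_opp = abelian_opp[OF abelian_category_axioms]

lemma epi_kernel_exact:
  assumes "k \<in> Hom A X Y" and "e \<in> Hom A Y Z" and "is_epi A e" and "is_kernel A k e"
  shows "short_exact A k e"
  using abelian_category.mono_cokernel_exact[OF abelian_category_opp, unfolded opp_simps] assms by blast

text \<open>The difference \<open>?m : K \<rightarrow> X \<oplus> Y\<close> of the two legs is mono because its first component \<open>k\<close> is, hence it
  is the kernel of the projection \<open>r\<close> onto the pushout. If \<open>b u = 0\<close>, then \<open>(0, u)\<close> factors through
  \<open>?m\<close> by some \<open>v\<close>; here \<open>k v = 0\<close>, so \<open>v = 0\<close> and \<open>u = 0\<close>.\<close>
lemma pushout_mono:
  assumes po: "is_pushout A K X Y E k l a b" and mono: "is_mono A k"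
  shows "is_mono A b"
proof -
  note d = pushoutD[OF po]
  obtain P i j p q where bp: "is_biproduct A X Y P i j p q"
    using ex_biproduct Hom_Obj d by metis
  note b = biproductD[OF bp]
  obtain l' where l': "l' \<in> Hom A K Y" "Plus A l l' = Zero A K Y" using ex_negative[OF d(2)] .
  let ?m = "Plus A (i \<cdot> k) (j \<cdot> l')"
  have m: "?m \<in> Hom A K P" using Plus_Hom[OF Comp_Hom[OF d(1) b(1)] Comp_Hom[OF l'(1) b(2)]] .
  obtain r where r: "r \<in> Hom A P E" "r \<cdot> i = a" "r \<cdot> j = b" using biproduct_copair[OF bp d(3,4)] .
  have "p \<cdot> ?m = Plus A (p \<cdot> i \<cdot> k) (p \<cdot> j \<cdot> l')"
    using Comp_Plus[OF Comp_Hom[OF d(1) b(1)] Comp_Hom[OF l'(1) b(2)] b(3)]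
      Comp_assoc[OF d(1) b(1,3)] Comp_assoc[OF l'(1) b(2,3)] by simp
  also have "\<dots> = k"
    using b(5,7) Ide_Comp[OF d(1)] Zero_Comp[OF l'(1)] Plus_Zero[OF d(1)] Hom_Obj[OF d(1)] by simp
  finally have pm: "p \<cdot> ?m = k" .
  have mm: "is_mono A ?m" using mono_first_factor[OF _ m b(3)] pm mono by simp
  have ker: "is_kernel A ?m r"
    using mono_cokernel_exact[OF m r(1) mm pushout_imp_cokernel[OF bp po l' r]] by (simp add: short_exact_def)
  show ?thesis
  proof (rule mono_from_Zero[OF d(4)])
    fix W u assume u: "u \<in> Hom A W Y" "b \<cdot> u = Zero A W E"
    have "r \<cdot> (j \<cdot> u) = Zero A W E" using Comp_assoc[OF u(1) b(2) r(1)] r u by simp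
    then obtain v where v: "v \<in> Hom A W K" "?m \<cdot> v = j \<cdot> u"
      using kernel_factor[OF ker m r(1) Comp_Hom[OF u(1) b(2)]] by blast
    have "k \<cdot> v = p \<cdot> j \<cdot> u" using Comp_assoc[OF v(1) m b(3)] Comp_assoc[OF u(1) b(2,3)] pm v by simp
    also have "\<dots> = Zero A W X" using b(7) Zero_Comp[OF u(1)] Hom_Obj[OF d(1)] by simp
    finally have "v = Zero A W K" using mono_reflects_Zero[OF mono d(1) v(1)] by blast
    then have ju: "j \<cdot> u = Zero A W P" using v(2) Comp_Zero[OF m] Hom_Obj[OF u(1)] by simp
    have "u = q \<cdot> (j \<cdot> u)" using Comp_assoc[OF u(1) b(2,4)] b(6) Ide_Comp[OF u(1)] by simp
    then show "u = Zero A W Y" using ju Comp_Zero[OF b(4)] Hom_Obj[OF u(1)] by simp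
  qed
qed

text \<open>For \<open>X \<subseteq> M\<^sub>1 \<subseteq> M\<close> this is \<open>0 \<rightarrow> M\<^sub>1/X \<rightarrow> M/X \<rightarrow> M/M\<^sub>1 \<rightarrow> 0\<close>, with \<open>F = M\<^sub>1/X\<close> and \<open>Y = M/X\<close>. The square
  formed by \<open>M\<^sub>1, M, F, Y\<close> is a pushout, so the monomorphism \<open>i\<close> and its cokernel pass to \<open>F \<rightarrow> Y\<close>.\<close>
lemma third_isomorphism:
  assumes i: "i \<in> Hom A M\<^sub>1 M" and d: "d \<in> Hom A M M\<^sub>2" and id: "short_exact A i d"
    and k: "k \<in> Hom A X M\<^sub>1" and e: "e \<in> Hom A M\<^sub>1 F" and ke: "short_exact A k e"
    and c: "c \<in> Hom A M Y" and ck: "is_cokernel A c (i \<cdot> k)"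
  shows "\<exists>m \<in> Hom A F Y. \<exists>n \<in> Hom A Y M\<^sub>2.
    m \<cdot> e = c \<cdot> i \<and> n \<cdot> c = d \<and> short_exact A m n"
proof -
  have idD: "is_kernel A i d" "is_cokernel A d i" and keD: "is_kernel A k e" "is_cokernel A e k"
    using id ke by (auto simp: short_exact_def)
  note i' = kernelD[OF idD(1) i d] and d' = cokernelD[OF idD(2) i d]
  note k' = kernelD[OF keD(1) k e] and e' = cokernelD[OF keD(2) k e]
  note ik = Comp_Hom[OF k i]
  note c' = cokernelD[OF ck ik c]
  have "c \<cdot> i \<cdot> k = Zero A X Y" using c'(1) Comp_assoc[OF k i c] by simp
  then obtain m where m: "m \<in> Hom A F Y" "m \<cdot> e = c \<cdot> i" using e'(3)[OF Comp_Hom[OF i c]] by blast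
  have po: "is_pushout A M\<^sub>1 M F Y i e c m"
    unfolding is_pushout_def
  proof (intro conjI allI ballI impI)
    fix W x y assume x: "x \<in> Hom A M W" and y: "y \<in> Hom A F W" and eq: "x \<cdot> i = y \<cdot> e"
    have "x \<cdot> (i \<cdot> k) = y \<cdot> e \<cdot> k" using Comp_assoc[OF k i x] eq by simp
    also have "\<dots> = Zero A X W" using Comp_assoc[OF k e y] k'(1) Comp_Zero[OF y] Hom_Obj[OF k] by simp
    finally obtain u where u: "u \<in> Hom A Y W" "u \<cdot> c = x" using c'(3)[OF x] by blast
    have "u \<cdot> m \<cdot> e = y \<cdot> e" using Comp_assoc[OF e m(1) u(1)] Comp_assoc[OF i c u(1)] m u eq by simp
    then have um: "u \<cdot> m = y" using epi_cancel[OF e'(2) e Comp_Hom[OF m(1) u(1)] y] by blast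
    show "\<exists>!u. u \<in> Hom A Y W \<and> u \<cdot> c = x \<and> u \<cdot> m = y"
      using u um epi_cancel[OF c'(2) c] by blast
  qed (use i e c m in auto)
  obtain n where n: "n \<in> Hom A Y M\<^sub>2" "n \<cdot> c = d" "is_cokernel A n m" using pushout_cokernel[OF po d idD(2)] .
  have "short_exact A m n" using mono_cokernel_exact[OF m(1) n(1) pushout_mono[OF po i'(2)] n(3)] .
  then show ?thesis using m n by blast
qed

text \<open>Here \<open>N = M/M\<^sub>0\<close>, and the kernel \<open>X\<close> of \<open>M \<rightarrow> N \<rightarrow> N/T\<close> is the preimage of \<open>T \<subseteq> N\<close> in \<open>M\<close>.\<close>
lemma third_isomorphism_dual:
  assumes "j \<in> Hom A M\<^sub>0 M" and "q \<in> Hom A M N" and "short_exact A j q"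
    and "t \<in> Hom A T N" and "g \<in> Hom A N F" and "short_exact A t g"
    and "k \<in> Hom A X M" and "is_kernel A k (g \<cdot> q)"
  shows "\<exists>m \<in> Hom A M\<^sub>0 X. \<exists>n \<in> Hom A X T.
    k \<cdot> m = j \<and> t \<cdot> n = q \<cdot> k \<and> short_exact A m n"
  using abelian_category.third_isomorphism[OF abelian_category_opp, unfolded opp_simps] assms by blast

end

section \<open>Torsion pairs\<close>

lemma torsion_pairD:
  assumes "torsion_pair A T F"
  shows "T \<subseteq> Obj A" "F \<subseteq> Obj A" "iso_closed A T" "iso_closed A F"
    and torsion_hom: "\<And>X Y h. \<lbrakk>X \<in> T; Y \<in> F; h \<in> Hom A X Y\<rbrakk> \<Longrightarrow> h = Zero A X Y"
    and torsion_sequence: "\<And>M. M \<in> Obj A \<Longrightarrow>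
      \<exists>X \<in> T. \<exists>Y \<in> F. \<exists>f \<in> Hom A X M. \<exists>g \<in> Hom A M Y. short_exact A f g"
  using assms unfolding torsion_pair_def by blast+

context preadditive_category
begin

text \<open>The torsion part of \<open>M\<close> is a right approximation: a map from \<open>T\<close> to \<open>M\<close> vanishes in the
  torsion-free quotient. The argument uses the preadditive structure only, so that it applies to
  full subcategories as well.\<close>
lemma torsion_contravariantly_finite:
  assumes tp: "torsion_pair A T F" shows "contravariantly_finite A T"
  unfolding contravariantly_finite_def
proof
  fix M assume "M \<in> Obj A"
  then obtain X Y f g where XY: "X \<in> T" "Y \<in> F" and f: "f \<in> Hom A X M" and g: "g \<in> Hom A M Y"
    and ex: "short_exact A f g"
    using torsion_sequence[OF tp] by blast
  have "\<exists>u \<in> Hom A X' X. f \<cdot> u = h" if "X' \<in> T" "h \<in> Hom A X' M" for X' h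
    using kernel_factor[OF _ f g that(2)] torsion_hom[OF tp that(1) XY(2) Comp_Hom[OF that(2) g]] ex
    by (simp add: short_exact_def)
  then show "\<exists>f. right_approximation A T M f"
    unfolding right_approximation_def using XY f by blast
qed

end

context abelian_category
begin

text \<open>If no nonzero map goes from \<open>X\<close> to \<open>F\<close>, the torsion sequence of \<open>X\<close> has zero second map, so its
  first map is an isomorphism. All closure properties of torsion classes are read off from this.\<close>
lemma torsion_iff:
  assumes tp: "torsion_pair A T F"
  shows "X \<in> T \<longleftrightarrow> X \<in> Obj A \<and> (\<forall>Y \<in> F. \<forall>h \<in> Hom A X Y. h = Zero A X Y)"
proof
  assume X: "X \<in> Obj A \<and> (\<forall>Y \<in> F. \<forall>h \<in> Hom A X Y. h = Zero A X Y)"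
  then obtain T' F' f g where TF: "T' \<in> T" "F' \<in> F" and f: "f \<in> Hom A T' X" and g: "g \<in> Hom A X F'"
    and ex: "short_exact A f g"
    using torsion_sequence[OF tp] by blast
  have k: "is_kernel A f g" using ex by (simp add: short_exact_def)
  have IX: "Ide A X \<in> Hom A X X" using X Ide_Hom by blast
  have "g \<cdot> Ide A X = Zero A X F'" using X TF g Comp_Ide[OF g] by simp
  then obtain u where u: "u \<in> Hom A X T'" "f \<cdot> u = Ide A X" using kernel_factor[OF k f g IX] by blast
  have "f \<cdot> (u \<cdot> f) = f \<cdot> Ide A T'"
    using Comp_assoc[OF f u(1) f] u(2) Ide_Comp[OF f] Comp_Ide[OF f] by simp
  then have "u \<cdot> f = Ide A T'"
    using mono_cancel[OF kernel_mono[OF k f g] f Comp_Hom[OF f u(1)] Ide_Hom] Hom_Obj[OF f] by blast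
  then have "isomorphic A T' X" using f u unfolding isomorphic_def by blast
  then show "X \<in> T" using torsion_pairD(3)[OF tp] TF X unfolding iso_closed_def by blast
qed (use torsion_pairD(1)[OF tp] torsion_hom[OF tp] in blast)

lemma torsion_free_iff:
  assumes "torsion_pair A T F"
  shows "Y \<in> F \<longleftrightarrow> Y \<in> Obj A \<and> (\<forall>X \<in> T. \<forall>h \<in> Hom A X Y. h = Zero A X Y)"
  using abelian_category.torsion_iff[OF abelian_category_opp, unfolded opp_simps] assms torsion_pair_opp
  by blast

lemma torsion_quotient:
  assumes tp: "torsion_pair A T F" and X: "X \<in> T" and e: "e \<in> Hom A X Y" "is_epi A e"
  shows "Y \<in> T"
  unfolding torsion_iff[OF tp]
proof (intro conjI ballI)
  fix Z h assume "Z \<in> F" and h: "h \<in> Hom A Y Z"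
  then have "h \<cdot> e = Zero A X Z" using torsion_hom[OF tp X] Comp_Hom[OF e(1) h] by blast
  then show "h = Zero A Y Z" using epi_reflects_Zero[OF e(2,1) h] by blast
qed (use Hom_Obj[OF e(1)] in blast)

lemma torsion_free_subobject:
  assumes "torsion_pair A T F" and "Y \<in> F" and "m \<in> Hom A X Y" "is_mono A m"
  shows "X \<in> F"
  using abelian_category.torsion_quotient[OF abelian_category_opp, unfolded opp_simps] assms torsion_pair_opp
  by blast

lemma torsion_zero_object:
  assumes tp: "torsion_pair A T F" and Z: "is_zero_object A Z"
  shows "Z \<in> T"
  unfolding torsion_iff[OF tp]
proof (intro conjI ballI)
  fix W h assume "W \<in> F" and h: "h \<in> Hom A Z W"
  then show "h = Zero A Z W" using Z Zero_Hom Hom_Obj[OF h] unfolding is_zero_object_def by blast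
qed (use Z in \<open>simp add: is_zero_object_def\<close>)

lemma torsion_free_zero_object:
  assumes "torsion_pair A T F" and "is_zero_object A Z" shows "Z \<in> F"
  using abelian_category.torsion_zero_object[OF abelian_category_opp, unfolded opp_simps] assms torsion_pair_opp
  by blast

lemma torsion_biproduct:
  assumes tp: "torsion_pair A T F" and XY: "X \<in> T" "Y \<in> T" and bp: "is_biproduct A X Y P i j p q"
  shows "P \<in> T"
  unfolding torsion_iff[OF tp]
proof (intro conjI ballI)
  note b = biproductD[OF bp]
  fix W h assume W: "W \<in> F" and h: "h \<in> Hom A P W"
  have "h \<cdot> i = Zero A X W" "h \<cdot> j = Zero A Y W"
    using torsion_hom[OF tp _ W] XY Comp_Hom[OF b(1) h] Comp_Hom[OF b(2) h] by blast+
  then show "h = Zero A P W"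
    using biproduct_hom_eq[OF bp h Zero_Hom] b(10) Hom_Obj[OF h] Zero_Comp[OF b(1)] Zero_Comp[OF b(2)] by simp
qed (rule biproductD[OF bp])

lemma torsion_free_biproduct:
  assumes "torsion_pair A T F" and "X \<in> F" "Y \<in> F" and "is_biproduct A X Y P i j p q"
  shows "P \<in> F"
  using abelian_category.torsion_biproduct[OF abelian_category_opp, unfolded opp_simps] assms torsion_pair_opp
  by blast

end

section \<open>Full subcategories\<close>

lemma full_sel [simp]:
  "Obj (full_subcat A S) = Obj A \<inter> S" "Dom (full_subcat A S) = Dom A" "Cod (full_subcat A S) = Cod A"
  "Ide (full_subcat A S) = Ide A" "Comp (full_subcat A S) = Comp A" "Plus (full_subcat A S) = Plus A"
  "Zero (full_subcat A S) = Zero A"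
  by (simp_all add: full_subcat_def)

lemma Hom_full: "f \<in> Hom (full_subcat A S) X Y \<longleftrightarrow> f \<in> Hom A X Y \<and> X \<in> S \<and> Y \<in> S"
  by (auto simp: Hom_def full_subcat_def)

lemma Hom_full_eq: "\<lbrakk>X \<in> S; Y \<in> S\<rbrakk> \<Longrightarrow> Hom (full_subcat A S) X Y = Hom A X Y"
  by (auto simp: Hom_def full_subcat_def)

lemma hom_group_full: "\<lbrakk>X \<in> S; Y \<in> S\<rbrakk> \<Longrightarrow> hom_group (full_subcat A S) X Y = hom_group A X Y"
  by (simp add: hom_group_def Hom_full_eq)

lemma isomorphic_full: "\<lbrakk>X \<in> S; Y \<in> S\<rbrakk> \<Longrightarrow> isomorphic (full_subcat A S) X Y \<longleftrightarrow> isomorphic A X Y"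
  by (simp add: isomorphic_def Hom_full_eq)

lemma is_biproduct_full:
  "\<lbrakk>X \<in> S; Y \<in> S; P \<in> S\<rbrakk> \<Longrightarrow>
    is_biproduct (full_subcat A S) X Y P i j p q \<longleftrightarrow> is_biproduct A X Y P i j p q"
  by (auto simp: is_biproduct_def Hom_full)

lemma is_zero_object_full: "\<lbrakk>is_zero_object A Z; Z \<in> S\<rbrakk> \<Longrightarrow> is_zero_object (full_subcat A S) Z"
  by (simp add: is_zero_object_def Hom_full_eq)

lemma (in preadditive_category) preadditive_full: "preadditive_category (full_subcat A S)"
proof (intro preadditive_category.intro preadditive_category_axioms.intro category.intro)
  fix X Y assume "X \<in> Obj (full_subcat A S)" "Y \<in> Obj (full_subcat A S)"
  then show "comm_group (hom_group (full_subcat A S) X Y)" using Hom_group by (simp add: hom_group_full)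
next
  fix f assume "f \<in> Arr (full_subcat A S)"
  then show "Dom (full_subcat A S) f \<in> Obj (full_subcat A S)" "Cod (full_subcat A S) f \<in> Obj (full_subcat A S)"
    using Dom_Obj Cod_Obj by (auto simp: full_subcat_def)
qed (auto simp: Hom_full intro: Ide_Hom Comp_Hom Comp_Ide Ide_Comp Comp_assoc Comp_Plus Plus_Comp)

context preadditive_category
begin

lemma mono_full:
  assumes "is_mono A f" "f \<in> Hom A X Y" "X \<in> S" "Y \<in> S"
  shows "is_mono (full_subcat A S) f"
proof (rule preadditive_category.monoI[OF preadditive_full])
  show "f \<in> Hom (full_subcat A S) X Y" using assms by (simp add: Hom_full)
  fix W u v
  assume "u \<in> Hom (full_subcat A S) W X" "v \<in> Hom (full_subcat A S) W X"
    "f \<cdot>\<^bsub>full_subcat A S\<^esub> u = f \<cdot>\<^bsub>full_subcat A S\<^esub> v"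
  then show "u = v" using mono_cancel[OF assms(1,2), of u W v] by (simp add: Hom_full)
qed

lemma kernel_full:
  assumes ker: "is_kernel A k f" and k: "k \<in> Hom A X Y" and f: "f \<in> Hom A Y Z" and S: "X \<in> S" "Y \<in> S" "Z \<in> S"
  shows "is_kernel (full_subcat A S) k f"
proof (rule preadditive_category.kernelI[OF preadditive_full])
  show "k \<in> Hom (full_subcat A S) X Y" "f \<in> Hom (full_subcat A S) Y Z" using assms by (simp_all add: Hom_full)
  show "is_mono (full_subcat A S) k" using mono_full[OF kernel_mono[OF ker k f] k] S by blast
  show "f \<cdot>\<^bsub>full_subcat A S\<^esub> k = Zero (full_subcat A S) X Z" using kernel_zero[OF ker k f] by simp
  fix W h assume "h \<in> Hom (full_subcat A S) W Y" "f \<cdot>\<^bsub>full_subcat A S\<^esub> h = Zero (full_subcat A S) W Z"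
  then show "\<exists>u \<in> Hom (full_subcat A S) W X. k \<cdot>\<^bsub>full_subcat A S\<^esub> u = h"
    using kernel_factor[OF ker k f, of h W] S by (auto simp: Hom_full)
qed

lemma cokernel_full:
  assumes "is_cokernel A c f" and "f \<in> Hom A X Y" and "c \<in> Hom A Y Z" and "X \<in> S" "Y \<in> S" "Z \<in> S"
  shows "is_cokernel (full_subcat A S) c f"
  using preadditive_category.kernel_full[OF preadditive_category_opp, unfolded opp_simps] assms by blast

lemma short_exact_full:
  assumes "short_exact A f g" and "f \<in> Hom A X Y" and "g \<in> Hom A Y Z" and "X \<in> S" "Y \<in> S" "Z \<in> S"
  shows "short_exact (full_subcat A S) f g"
  using kernel_full[OF _ assms(2-6)] cokernel_full[OF _ assms(2-6)] assms(1) by (simp add: short_exact_def)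

lemma left_approximation_full:
  assumes "left_approximation A U M f" "U \<subseteq> S" "M \<in> S"
  shows "left_approximation (full_subcat A S) U M f"
proof -
  obtain X where X: "X \<in> U" "f \<in> Hom A M X"
    and ap: "\<And>X' h. X' \<in> U \<Longrightarrow> h \<in> Hom A M X' \<Longrightarrow> \<exists>u \<in> Hom A X X'. u \<cdot> f = h"
    using assms(1) unfolding left_approximation_def by blast
  show ?thesis unfolding left_approximation_def
  proof (intro bexI[OF _ X(1)] conjI ballI)
    fix X' h assume "X' \<in> U" "h \<in> Hom (full_subcat A S) M X'"
    moreover have "X \<in> S" using X assms by blast
    ultimately show "\<exists>u \<in> Hom (full_subcat A S) X X'. u \<cdot>\<^bsub>full_subcat A S\<^esub> f = h"
      using ap[of X' h] by (auto simp: Hom_full)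
  qed (use X assms in \<open>auto simp: Hom_full\<close>)
qed

text \<open>Covariant finiteness is transitive: approximate \<open>M\<close> in \<open>S\<close>, then the result in \<open>U\<close>.\<close>
lemma left_approximation_trans:
  assumes f: "left_approximation A S M f" and f': "f \<in> Hom A M N"
    and g: "left_approximation (full_subcat A S) U N g" and "U \<subseteq> S"
  shows "left_approximation A U M (g \<cdot> f)"
proof -
  obtain N' where N': "f \<in> Hom A M N'"
    and ap': "\<And>X' h. X' \<in> S \<Longrightarrow> h \<in> Hom A M X' \<Longrightarrow> \<exists>u \<in> Hom A N' X'. u \<cdot> f = h"
    using f unfolding left_approximation_def by blast
  have ap: "\<exists>u \<in> Hom A N X'. u \<cdot> f = h" if "X' \<in> S" "h \<in> Hom A M X'" for X' h
    using ap'[OF that] HomD(3)[OF N'] HomD(3)[OF f'] by simp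
  obtain X where X: "X \<in> U" "g \<in> Hom A N X" "N \<in> S"
    and ap2: "\<And>X' h. X' \<in> U \<Longrightarrow> h \<in> Hom (full_subcat A S) N X' \<Longrightarrow>
      \<exists>u \<in> Hom (full_subcat A S) X X'. u \<cdot> g = h"
    using g unfolding left_approximation_def by (auto simp: Hom_full)
  show ?thesis unfolding left_approximation_def
  proof (intro bexI[OF _ X(1)] conjI ballI)
    show "g \<cdot> f \<in> Hom A M X" using Comp_Hom[OF f' X(2)] .
    fix X' h assume X': "X' \<in> U" and h: "h \<in> Hom A M X'"
    then obtain u where u: "u \<in> Hom A N X'" "u \<cdot> f = h" using ap assms(4) by blast
    have "u \<in> Hom (full_subcat A S) N X'" using u X X' assms(4) by (auto simp: Hom_full)
    then obtain v where v: "v \<in> Hom A X X'" "v \<cdot> g = u"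
      using ap2[OF X', of u] by (auto simp: Hom_full)
    then show "\<exists>v \<in> Hom A X X'. v \<cdot> (g \<cdot> f) = h"
      using Comp_assoc[OF f' X(2) v(1)] u by auto
  qed
qed

end

section \<open>The interval between two torsion classes\<close>

locale torsion_interval = abelian_category +
  fixes C D C' D' :: "'a set"
  assumes tp: "torsion_pair A C D" and tp': "torsion_pair A C' D'" and C_sub: "C \<subseteq> C'"
begin

lemma D'_sub: "D' \<subseteq> D"
proof
  fix Y assume "Y \<in> D'"
  then show "Y \<in> D" using torsion_free_iff[OF tp] torsion_free_iff[OF tp'] C_sub by blast
qed

text \<open>The self-duality of the situation: everything proved in this locale also holds with
  \<open>(D', C'), (D, C)\<close> in \<open>opp A\<close>, whose intersection \<open>D \<inter> C'\<close> is the same subcategory.\<close>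
lemma torsion_interval_opp: "torsion_interval (opp A) D' C' D C"
  using abelian_category_opp tp tp' D'_sub
  by (simp add: torsion_interval_def torsion_interval_axioms_def)

abbreviation heart :: "('a, 'b, 'c) precat_scheme" where
  "heart \<equiv> full_subcat A (C' \<inter> D)"

lemma heart_opp: "full_subcat (opp A) (D \<inter> C') = opp heart"
  by (simp add: Int_commute)

lemmas interval_opp_simps = heart_opp opp_simps Int_commute[of D C']

lemma heart_preadditive: "preadditive_category heart"
  by (rule preadditive_full)

lemma heart_additive: "additive_category heart"
proof (intro additive_category.intro additive_category_axioms.intro heart_preadditive)
  obtain Z where Z: "is_zero_object A Z" using ex_zero_object by blast
  then have "Z \<in> C' \<inter> D" using torsion_zero_object[OF tp'] torsion_free_zero_object[OF tp] by blast
  then show "\<exists>Z. is_zero_object heart Z" using is_zero_object_full[OF Z] by blast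
next
  fix X Y assume *: "X \<in> Obj heart" "Y \<in> Obj heart"
  then obtain P i j p q where bp: "is_biproduct A X Y P i j p q" using ex_biproduct[of X Y] by auto
  then have "P \<in> C' \<inter> D"
    using torsion_biproduct[OF tp' _ _ bp] torsion_free_biproduct[OF tp _ _ bp] * by simp
  then have "is_biproduct heart X Y P i j p q" using is_biproduct_full[of X "C' \<inter> D" Y P A] bp * by simp
  then show "\<exists>P i j p q. is_biproduct heart X Y P i j p q" by blast
qed

text \<open>The kernel \<open>K\<close> formed in \<open>A\<close> lies in \<open>D\<close>, being a subobject of \<open>Y\<close>, but it may fail to lie in \<open>C'\<close>.
  Its \<open>C'\<close>-part \<open>K\<^sub>1\<close> lies in both and still receives every map from \<open>C'\<close> to \<open>K\<close>. The sequence
  \<open>K\<^sub>1 \<rightarrow> K \<rightarrow> E\<close> is part of the conclusion because the defect \<open>E \<in> D'\<close> has to be controlled in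
  \<open>heart_short_exact\<close>.\<close>
lemma heart_kernel:
  assumes g: "g \<in> Hom A Y Z" and YZ: "Y \<in> C' \<inter> D" "Z \<in> C' \<inter> D"
    and \<kappa>: "\<kappa> \<in> Hom A K Y" and ker: "is_kernel A \<kappa> g"
  shows "\<exists>K\<^sub>1 \<in> C' \<inter> D. \<exists>E \<in> D'. \<exists>\<tau> \<in> Hom A K\<^sub>1 K. \<exists>\<delta> \<in> Hom A K E.
    short_exact A \<tau> \<delta> \<and> is_kernel heart (\<kappa> \<cdot> \<tau>) g"
proof -
  note k = kernelD[OF ker \<kappa> g]
  obtain K1 E \<tau> \<delta> where K1: "K1 \<in> C'" and E: "E \<in> D'" and \<tau>: "\<tau> \<in> Hom A K1 K" and \<delta>: "\<delta> \<in> Hom A K E"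
    and ex: "short_exact A \<tau> \<delta>"
    using torsion_sequence[OF tp'] Hom_Obj[OF \<kappa>] by blast
  have ker': "is_kernel A \<tau> \<delta>" using ex by (simp add: short_exact_def)
  note t = kernelD[OF ker' \<tau> \<delta>]
  note \<kappa>\<tau> = Comp_Hom[OF \<tau> \<kappa>]
  have mono: "is_mono A (\<kappa> \<cdot> \<tau>)" using mono_Comp[OF t(2) k(2) \<tau> \<kappa>] .
  have K1': "K1 \<in> C' \<inter> D" using torsion_free_subobject[OF tp _ \<kappa>\<tau> mono] YZ K1 by blast
  have "is_kernel heart (\<kappa> \<cdot> \<tau>) g"
  proof (rule preadditive_category.kernelI[OF heart_preadditive])
    show "\<kappa> \<cdot> \<tau> \<in> Hom heart K1 Y" "g \<in> Hom heart Y Z" using \<kappa>\<tau> g K1' YZ by (simp_all add: Hom_full)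
    show "g \<cdot>\<^bsub>heart\<^esub> (\<kappa> \<cdot> \<tau>) = Zero heart K1 Z"
      using Comp_assoc[OF \<tau> \<kappa> g] k(1) Zero_Comp[OF \<tau>] Hom_Obj[OF g] by simp
    show "is_mono heart (\<kappa> \<cdot> \<tau>)" using mono_full[OF mono \<kappa>\<tau> K1' YZ(1)] .
    fix W h assume h: "h \<in> Hom heart W Y" "g \<cdot>\<^bsub>heart\<^esub> h = Zero heart W Z"
    then have W: "W \<in> C' \<inter> D" and h': "h \<in> Hom A W Y" "g \<cdot> h = Zero A W Z" by (simp_all add: Hom_full)
    obtain x where x: "x \<in> Hom A W K" "\<kappa> \<cdot> x = h" using k(3)[OF h'] by blast
    have "\<delta> \<cdot> x = Zero A W E" using torsion_hom[OF tp' _ E Comp_Hom[OF x(1) \<delta>]] W by blast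
    then obtain y where y: "y \<in> Hom A W K1" "\<tau> \<cdot> y = x" using t(3)[OF x(1)] by blast
    have "y \<in> Hom heart W K1" using y W K1' by (simp add: Hom_full)
    then show "\<exists>u \<in> Hom heart W K1. (\<kappa> \<cdot> \<tau>) \<cdot>\<^bsub>heart\<^esub> u = h"
      using Comp_assoc[OF y(1) \<tau> \<kappa>] x y by auto
  qed
  then show ?thesis using K1' E \<tau> \<delta> ex by blast
qed

lemma heart_has_kernels:
  assumes "g \<in> Arr heart" shows "\<exists>k. is_kernel heart k g"
proof -
  define Y Z where "Y = Dom A g" and "Z = Cod A g"
  have g: "g \<in> Hom A Y Z" "Y \<in> C' \<inter> D" "Z \<in> C' \<inter> D"
    using assms by (auto simp: full_subcat_def Hom_def Y_def Z_def)
  obtain K \<kappa> where "\<kappa> \<in> Hom A K Y" "is_kernel A \<kappa> g" using obtain_kernel[OF g(1)] .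
  then show ?thesis using heart_kernel[OF g] by blast
qed

lemma heart_has_cokernels:
  assumes "g \<in> Arr heart" shows "\<exists>c. is_cokernel heart c g"
  using torsion_interval.heart_has_kernels[OF torsion_interval_opp, unfolded interval_opp_simps] assms
  by blast

lemma heart_pre_abelian: "pre_abelian_category heart"
  by (intro pre_abelian_category.intro pre_abelian_category_axioms.intro heart_additive
      heart_has_kernels heart_has_cokernels)

text \<open>Any kernel \<open>f\<close> of \<open>g\<close> in the heart is isomorphic to the one of \<open>heart_kernel\<close>, so it differs from
  the kernel \<open>\<kappa>\<close> in \<open>A\<close> by an object \<open>E\<close> of \<open>D'\<close>. The isomorphism is \<open>u\<close>, with inverse \<open>v\<close>.\<close>
lemma heart_kernel_factor:
  assumes f: "f \<in> Hom A X Y" and g: "g \<in> Hom A Y Z" and S: "X \<in> C' \<inter> D" "Y \<in> C' \<inter> D" "Z \<in> C' \<inter> D"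
    and hk: "is_kernel heart f g" and \<kappa>: "\<kappa> \<in> Hom A K Y" and ker: "is_kernel A \<kappa> g"
  shows "\<exists>E \<in> D'. \<exists>f' \<in> Hom A X K. \<exists>\<delta> \<in> Hom A K E. \<kappa> \<cdot> f' = f \<and> short_exact A f' \<delta>"
proof -
  obtain K1 E \<tau> \<delta> where K1: "K1 \<in> C' \<inter> D" and E: "E \<in> D'"
    and \<tau>: "\<tau> \<in> Hom A K1 K" and \<delta>: "\<delta> \<in> Hom A K E"
    and ex: "short_exact A \<tau> \<delta>" and hk': "is_kernel heart (\<kappa> \<cdot> \<tau>) g"
    using heart_kernel[OF g S(2,3) \<kappa> ker] by blast
  note k = kernelD[OF ker \<kappa> g]
  have ex': "is_kernel A \<tau> \<delta>" "is_cokernel A \<delta> \<tau>" using ex by (simp_all add: short_exact_def)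
  note t = kernelD[OF ex'(1) \<tau> \<delta>]
  note \<kappa>\<tau> = Comp_Hom[OF \<tau> \<kappa>]
  have f\<^sub>H: "f \<in> Hom heart X Y" and g\<^sub>H: "g \<in> Hom heart Y Z" and \<kappa>\<tau>\<^sub>H: "\<kappa> \<cdot> \<tau> \<in> Hom heart K1 Y"
    using f g \<kappa>\<tau> S K1 by (simp_all add: Hom_full)
  note h = preadditive_category.kernelD[OF heart_preadditive hk f\<^sub>H g\<^sub>H, simplified]
  note h' = preadditive_category.kernelD[OF heart_preadditive hk' \<kappa>\<tau>\<^sub>H g\<^sub>H, simplified]
  obtain u where u: "u \<in> Hom A X K1" "\<kappa> \<cdot> \<tau> \<cdot> u = f" using h'(3)[OF f\<^sub>H h(1)] by (auto simp: Hom_full)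
  obtain v where v: "v \<in> Hom A K1 X" "f \<cdot> v = \<kappa> \<cdot> \<tau>" using h(3)[OF \<kappa>\<tau>\<^sub>H h'(1)] by (auto simp: Hom_full)
  have vu: "v \<cdot> u = Ide A X"
  proof (rule preadditive_category.mono_cancel[OF heart_preadditive h(2) f\<^sub>H])
    show "v \<cdot> u \<in> Hom heart X X" "Ide A X \<in> Hom heart X X"
      using Comp_Hom[OF u(1) v(1)] Ide_Hom Hom_Obj[OF f] S by (simp_all add: Hom_full)
    show "f \<cdot>\<^bsub>heart\<^esub> (v \<cdot> u) = f \<cdot>\<^bsub>heart\<^esub> Ide A X" using Comp_assoc[OF u(1) v(1) f] u v Comp_Ide[OF f] by simp
  qed
  define f' where "f' = \<tau> \<cdot> u"
  have f': "f' \<in> Hom A X K" unfolding f'_def using Comp_Hom[OF u(1) \<tau>] .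
  have \<kappa>f': "\<kappa> \<cdot> f' = f" unfolding f'_def using Comp_assoc[OF u(1) \<tau> \<kappa>] u by simp
  have "is_mono A u"
    using mono_first_factor[OF _ u(1) v(1)] vu Ide_mono Hom_Obj[OF f] by simp
  then have mono: "is_mono A f'" unfolding f'_def using mono_Comp[OF _ t(2) u(1) \<tau>] by blast
  have "is_kernel A f' \<delta>"
  proof (rule kernelI[OF f' \<delta> _ mono])
    show "\<delta> \<cdot> f' = Zero A X E" using torsion_hom[OF tp' _ E Comp_Hom[OF f' \<delta>]] S by blast
    fix W x assume x: "x \<in> Hom A W K" "\<delta> \<cdot> x = Zero A W E"
    then obtain y where y: "y \<in> Hom A W K1" "\<tau> \<cdot> y = x" using t(3) by blast
    have "\<kappa> \<cdot> (f' \<cdot> v) = \<kappa> \<cdot> \<tau>" using Comp_assoc[OF v(1) f' \<kappa>] \<kappa>f' v by simp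
    then have "f' \<cdot> v = \<tau>" using mono_cancel[OF k(2) \<kappa> Comp_Hom[OF v(1) f'] \<tau>] by blast
    then have "f' \<cdot> (v \<cdot> y) = x" using Comp_assoc[OF y(1) v(1) f'] y by simp
    then show "\<exists>z \<in> Hom A W X. f' \<cdot> z = x" using Comp_Hom[OF y(1) v(1)] by blast
  qed
  then have "short_exact A f' \<delta>" using epi_kernel_exact[OF f' \<delta>] cokernel_epi[OF ex'(2) \<tau> \<delta>] by blast
  then show ?thesis using E f' \<delta> \<kappa>f' by blast
qed

lemma heart_cokernel_factor:
  assumes "g \<in> Hom A Y X" and "f \<in> Hom A Z Y" and "X \<in> C' \<inter> D" "Y \<in> C' \<inter> D" "Z \<in> C' \<inter> D"
    and "is_cokernel heart g f" and "c \<in> Hom A Y Q" and "is_cokernel A c f"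
  shows "\<exists>E \<in> C. \<exists>g' \<in> Hom A Q X. \<exists>\<epsilon> \<in> Hom A E Q. g' \<cdot> c = g \<and> short_exact A \<epsilon> g'"
  using torsion_interval.heart_kernel_factor[OF torsion_interval_opp, unfolded interval_opp_simps,
      of g Y X f Z c Q] assms by blast

text \<open>With \<open>\<kappa> : K \<rightarrow> Y\<close> the kernel of \<open>g\<close> and \<open>c : Y \<rightarrow> Q\<close> the cokernel of \<open>f\<close> in \<open>A\<close>, the homology at \<open>Y\<close>
  is both \<open>E = K/X\<close> and \<open>E' = ker (Q \<rightarrow> Z)\<close>. The former lies in \<open>D'\<close>, the latter in \<open>C\<close>, and there are no
  nonzero maps from \<open>C \<subseteq> C'\<close> to \<open>D'\<close>.\<close>
lemma heart_short_exact:
  assumes f: "f \<in> Hom A X Y" and g: "g \<in> Hom A Y Z" and S: "X \<in> C' \<inter> D" "Y \<in> C' \<inter> D" "Z \<in> C' \<inter> D"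
    and ex: "short_exact heart f g"
  shows "short_exact A f g"
proof -
  have hk: "is_kernel heart f g" "is_cokernel heart g f" using ex by (simp_all add: short_exact_def)
  obtain K \<kappa> where \<kappa>: "\<kappa> \<in> Hom A K Y" and ker: "is_kernel A \<kappa> g" using obtain_kernel[OF g] .
  obtain Q c where c: "c \<in> Hom A Y Q" and ck: "is_cokernel A c f" using obtain_cokernel[OF f] .
  obtain E f' \<delta> where E: "E \<in> D'" and f': "f' \<in> Hom A X K" and \<delta>: "\<delta> \<in> Hom A K E"
    and \<kappa>f': "\<kappa> \<cdot> f' = f" and ex1: "short_exact A f' \<delta>"
    using heart_kernel_factor[OF f g S hk(1) \<kappa> ker] by blast
  obtain E' g' \<epsilon> where E': "E' \<in> C" and g': "g' \<in> Hom A Q Z" and \<epsilon>: "\<epsilon> \<in> Hom A E' Q"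
    and g'c: "g' \<cdot> c = g" and ex2: "short_exact A \<epsilon> g'"
    using heart_cokernel_factor[OF g f S(3,2,1) hk(2) c ck] by blast
  note k = kernelD[OF ker \<kappa> g] and ck' = cokernelD[OF ck f c]
  have e1: "is_kernel A f' \<delta>" "is_cokernel A \<delta> f'" and e2: "is_kernel A \<epsilon> g'" "is_cokernel A g' \<epsilon>"
    using ex1 ex2 by (simp_all add: short_exact_def)
  note kf' = kernelD[OF e1(1) f' \<delta>] and c\<delta> = cokernelD[OF e1(2) f' \<delta>]
  note cg' = cokernelD[OF e2(2) \<epsilon> g']
  have mono: "is_mono A f" using mono_Comp[OF kf'(2) k(2) f' \<kappa>] \<kappa>f' by simp
  have epi: "is_epi A g" using epi_Comp[OF ck'(2) cg'(2) c g'] g'c by simp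
  have exc: "short_exact A f c" using mono_cokernel_exact[OF f c mono ck] .
  \<comment> \<open>\<open>K\<close> is the preimage of \<open>E' \<subseteq> Q\<close> in \<open>Y\<close>, so \<open>E'\<close> is a cokernel of \<open>f' : X \<rightarrow> K\<close>, just as \<open>E\<close> is\<close>
  have "is_kernel A \<kappa> (g' \<cdot> c)" using ker g'c by simp
  then obtain m n where m: "m \<in> Hom A X K" and n: "n \<in> Hom A K E'" and \<kappa>m: "\<kappa> \<cdot> m = f"
    and mn: "short_exact A m n"
    using third_isomorphism_dual[OF f c exc \<epsilon> g' ex2 \<kappa>] by blast
  have "m = f'" using mono_cancel[OF k(2) \<kappa> m f'] \<kappa>m \<kappa>f' by simp
  then have "is_cokernel A n f'" using mn by (simp add: short_exact_def)
  then obtain w where w: "w \<in> Hom A E' E" "w \<cdot> n = \<delta>"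
    using cokernel_factor[OF _ f' n \<delta> c\<delta>(1)] by blast
  have "w = Zero A E' E" using torsion_hom[OF tp' _ E w(1)] E' C_sub by blast
  then have \<delta>0: "\<delta> = Zero A K E" using w Zero_Comp[OF n] Hom_Obj[OF \<delta>] by simp
  have "is_kernel A f g"
  proof (rule kernelI[OF f g _ mono])
    show "g \<cdot> f = Zero A X Z"
      using Comp_assoc[OF f' \<kappa> g] \<kappa>f' k(1) Zero_Comp[OF f'] Hom_Obj[OF g] by simp
    fix W h assume h: "h \<in> Hom A W Y" "g \<cdot> h = Zero A W Z"
    then obtain x where x: "x \<in> Hom A W K" "\<kappa> \<cdot> x = h" using k(3) by blast
    have "\<delta> \<cdot> x = Zero A W E" using \<delta>0 Zero_Comp[OF x(1)] Hom_Obj[OF \<delta>] by simp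
    then obtain y where y: "y \<in> Hom A W X" "f' \<cdot> y = x" using kf'(3)[OF x(1)] by blast
    have "f \<cdot> y = h" using Comp_assoc[OF y(1) f' \<kappa>] \<kappa>f' x y by simp
    then show "\<exists>y \<in> Hom A W X. f \<cdot> y = h" using y by blast
  qed
  then show ?thesis using epi_kernel_exact[OF f g epi] by blast
qed

section \<open>Torsion pairs inside the interval\<close>

text \<open>Let \<open>f : M \<rightarrow> U\<close> be a left \<open>X\<close>-approximation and \<open>g : U \<rightarrow> V\<close> the \<open>D\<close>-quotient of \<open>U\<close>. As a quotient of
  \<open>U\<close>, the object \<open>V\<close> stays in \<open>X\<close>, and maps from \<open>U\<close> to \<open>D\<close> factor through \<open>g\<close>.\<close>
lemma left_approximation_torsion_free_part:
  assumes tpX: "torsion_pair A X Y" and fin: "covariantly_finite A X" and M: "M \<in> Obj A"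
  shows "\<exists>f. left_approximation A (X \<inter> D) M f"
proof -
  obtain f U where U: "U \<in> X" and f: "f \<in> Hom A M U"
    and ap: "\<And>X' h. X' \<in> X \<Longrightarrow> h \<in> Hom A M X' \<Longrightarrow> \<exists>u \<in> Hom A U X'. u \<cdot> f = h"
    using fin M unfolding covariantly_finite_def left_approximation_def by blast
  obtain U' V j g where U': "U' \<in> C" and V: "V \<in> D" and j: "j \<in> Hom A U' U" and g: "g \<in> Hom A U V"
    and ex: "short_exact A j g"
    using torsion_sequence[OF tp] Hom_Obj[OF f] by blast
  have ck: "is_cokernel A g j" using ex by (simp add: short_exact_def)
  have VX: "V \<in> X \<inter> D" using torsion_quotient[OF tpX U g cokernel_epi[OF ck j g]] V by blast
  have "left_approximation A (X \<inter> D) M (g \<cdot> f)"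
    unfolding left_approximation_def
  proof (intro bexI[OF _ VX] conjI ballI)
    show "g \<cdot> f \<in> Hom A M V" using Comp_Hom[OF f g] .
    fix X' h assume X': "X' \<in> X \<inter> D" and h: "h \<in> Hom A M X'"
    obtain u where u: "u \<in> Hom A U X'" "u \<cdot> f = h" using ap[OF _ h] X' by blast
    have "u \<cdot> j = Zero A U' X'" using torsion_hom[OF tp U' _ Comp_Hom[OF j u(1)]] X' by blast
    then obtain v where v: "v \<in> Hom A V X'" "v \<cdot> g = u" using cokernel_factor[OF ck j g u(1)] by blast
    then show "\<exists>v \<in> Hom A V X'. v \<cdot> (g \<cdot> f) = h" using Comp_assoc[OF f g v(1)] u by auto
  qed
  then show ?thesis by blast
qed

lemma heart_functorially_finite:
  assumes tpX: "torsion_pair A X Y" and fin: "functorially_finite A X" and X: "C \<subseteq> X" "X \<subseteq> C'"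
    and htp: "torsion_pair heart (X \<inter> D) F"
  shows "functorially_finite heart (X \<inter> D)"
  unfolding functorially_finite_def
proof
  show "contravariantly_finite heart (X \<inter> D)"
    using preadditive_category.torsion_contravariantly_finite[OF heart_preadditive htp] .
  show "covariantly_finite heart (X \<inter> D)"
    unfolding covariantly_finite_def
  proof
    fix M assume M: "M \<in> Obj heart"
    have "covariantly_finite A X" using fin by (simp add: functorially_finite_def)
    then obtain f where f: "left_approximation A (X \<inter> D) M f"
      using left_approximation_torsion_free_part[OF tpX] M by auto
    have "left_approximation heart (X \<inter> D) M f"
      using left_approximation_full[OF f, of "C' \<inter> D"] X M by auto
    then show "\<exists>f. left_approximation heart (X \<inter> D) M f" by blast
  qed
qed

lemma heart_functorially_finite_free:
  assumes "torsion_pair A X Y" and "functorially_finite A Y" and "D' \<subseteq> Y" "Y \<subseteq> D"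
    and "torsion_pair heart T (Y \<inter> C')"
  shows "functorially_finite heart (Y \<inter> C')"
  using torsion_interval.heart_functorially_finite[OF torsion_interval_opp,
      unfolded interval_opp_simps torsion_pair_opp] assms by blast

text \<open>The torsion sequence in \<open>A\<close> of an object of the heart stays in the heart: its left end is a
  subobject of an object of \<open>D\<close>, its right end a quotient of an object of \<open>C'\<close>.\<close>
lemma heart_torsion_pair:
  assumes tpX: "torsion_pair A X Y" and X: "C \<subseteq> X" "X \<subseteq> C'"
  shows "torsion_pair heart (X \<inter> D) (Y \<inter> C')"
proof -
  have Y: "Y \<subseteq> D" "D' \<subseteq> Y"
    using torsion_free_iff[OF tp] torsion_free_iff[OF tp'] torsion_free_iff[OF tpX] X by blast+
  show ?thesis
    unfolding torsion_pair_def
  proof (intro conjI ballI heart_pre_abelian)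
    show "X \<inter> D \<subseteq> Obj heart" "Y \<inter> C' \<subseteq> Obj heart" using torsion_pairD(1,2)[OF tpX] X Y by auto
    show "iso_closed heart (X \<inter> D)"
      unfolding iso_closed_def
    proof (intro ballI impI)
      fix U V assume *: "U \<in> X \<inter> D" "V \<in> Obj heart" "isomorphic heart U V"
      then have "isomorphic A U V" using isomorphic_full[of U "C' \<inter> D" V A] X by auto
      then show "V \<in> X \<inter> D" using * torsion_pairD(3)[OF tpX] unfolding iso_closed_def by auto
    qed
    show "iso_closed heart (Y \<inter> C')"
      unfolding iso_closed_def
    proof (intro ballI impI)
      fix U V assume *: "U \<in> Y \<inter> C'" "V \<in> Obj heart" "isomorphic heart U V"
      then have "isomorphic A U V" using isomorphic_full[of U "C' \<inter> D" V A] Y by auto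
      then show "V \<in> Y \<inter> C'" using * torsion_pairD(4)[OF tpX] unfolding iso_closed_def by auto
    qed
    fix U V assume UV: "U \<in> X \<inter> D" "V \<in> Y \<inter> C'"
    then have "Hom heart U V = Hom A U V" using Hom_full_eq[of U "C' \<inter> D" V A] X Y by auto
    then show "Hom heart U V = {Zero heart U V}"
      using UV tpX unfolding torsion_pair_def by simp
  next
    fix M assume M: "M \<in> Obj heart"
    then obtain U V f g where UV: "U \<in> X" "V \<in> Y" and f: "f \<in> Hom A U M" and g: "g \<in> Hom A M V"
      and ex: "short_exact A f g"
      using torsion_sequence[OF tpX, of M] by auto
    have ker: "is_kernel A f g" and ck: "is_cokernel A g f" using ex by (simp_all add: short_exact_def)
    have U: "U \<in> D" using torsion_free_subobject[OF tp _ f kernel_mono[OF ker f g]] M by simp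
    have V: "V \<in> C'" using torsion_quotient[OF tp' _ g cokernel_epi[OF ck f g]] M by simp
    have S: "U \<in> C' \<inter> D" "M \<in> C' \<inter> D" "V \<in> C' \<inter> D" using U V UV X Y M by auto
    have "short_exact heart f g" using short_exact_full[OF ex f g S] .
    moreover have "f \<in> Hom heart U M" "g \<in> Hom heart M V" using f g S by (simp_all add: Hom_full)
    ultimately show "\<exists>U \<in> X \<inter> D. \<exists>V \<in> Y \<inter> C'. \<exists>f \<in> Hom heart U M. \<exists>g \<in> Hom heart M V.
        short_exact heart f g"
      using U V UV by blast
  qed
qed

proposition heart_ff_torsion_pair:
  assumes ff: "ff_torsion_pair A X Y" and X: "C \<subseteq> X" "X \<subseteq> C'"
  shows "ff_torsion_pair heart (X \<inter> D) (Y \<inter> C')"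
proof -
  have tpX: "torsion_pair A X Y" and fin: "functorially_finite A X" "functorially_finite A Y"
    using ff by (simp_all add: ff_torsion_pair_def)
  have Y: "D' \<subseteq> Y" "Y \<subseteq> D"
    using torsion_free_iff[OF tp] torsion_free_iff[OF tp'] torsion_free_iff[OF tpX] X by blast+
  note htp = heart_torsion_pair[OF tpX X]
  show ?thesis
    using htp heart_functorially_finite[OF tpX fin(1) X htp]
      heart_functorially_finite_free[OF tpX fin(2) Y htp]
    by (simp add: ff_torsion_pair_def)
qed

end

section \<open>Extension classes\<close>

context abelian_category
begin

lemma extensionsI:
  assumes "f \<in> Hom A X M" "g \<in> Hom A M Y" "short_exact A f g" "X \<in> U" "Y \<in> V"
  shows "M \<in> extensions A U V"
  using assms Hom_Obj[OF assms(2)] unfolding extensions_def by blast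

lemma extensionsE:
  assumes "M \<in> extensions A U V"
  obtains X Y f g where "X \<in> U" "Y \<in> V" "f \<in> Hom A X M" "g \<in> Hom A M Y" "is_kernel A f g" "is_cokernel A g f"
  using assms unfolding extensions_def short_exact_def by blast

lemma iso_closed_extensions: "iso_closed A (extensions A U V)"
  unfolding iso_closed_def
proof (intro ballI impI)
  fix M N assume M: "M \<in> extensions A U V" and MN: "isomorphic A M N"
  obtain X Y f g where XY: "X \<in> U" "Y \<in> V" and f: "f \<in> Hom A X M" and g: "g \<in> Hom A M Y"
    and ker: "is_kernel A f g" and ck: "is_cokernel A g f"
    using extensionsE[OF M] .
  obtain \<alpha> \<beta> where \<alpha>: "\<alpha> \<in> Hom A M N" and \<beta>: "\<beta> \<in> Hom A N M"
    and \<alpha>\<beta>: "\<beta> \<cdot> \<alpha> = Ide A M" "\<alpha> \<cdot> \<beta> = Ide A N"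
    using MN unfolding isomorphic_def by blast
  note k = kernelD[OF ker f g]
  have \<alpha>f: "\<alpha> \<cdot> f \<in> Hom A X N" and g\<beta>: "g \<cdot> \<beta> \<in> Hom A N Y" using Comp_Hom f g \<alpha> \<beta> by blast+
  have g\<beta>\<alpha>: "g \<cdot> \<beta> \<cdot> \<alpha> = g" using Comp_assoc[OF \<alpha> \<beta> g] \<alpha>\<beta> Comp_Ide[OF g] by simp
  have "is_mono A \<alpha>" using mono_first_factor[OF _ \<alpha> \<beta>] \<alpha>\<beta> Ide_mono Hom_Obj[OF g] by simp
  then have mono: "is_mono A (\<alpha> \<cdot> f)" using mono_Comp[OF k(2) _ f \<alpha>] by blast
  have epi: "is_epi A (g \<cdot> \<beta>)" using epi_second_factor[OF _ \<alpha> g\<beta>] g\<beta>\<alpha> cokernel_epi[OF ck f g] by simp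
  have "is_kernel A (\<alpha> \<cdot> f) (g \<cdot> \<beta>)"
  proof (rule kernelI[OF \<alpha>f g\<beta> _ mono])
    show "g \<cdot> \<beta> \<cdot> (\<alpha> \<cdot> f) = Zero A X Y" using Comp_assoc[OF f \<alpha> g\<beta>] g\<beta>\<alpha> k(1) by simp
    fix W h assume h: "h \<in> Hom A W N" "g \<cdot> \<beta> \<cdot> h = Zero A W Y"
    then obtain u where u: "u \<in> Hom A W X" "f \<cdot> u = \<beta> \<cdot> h"
      using k(3)[OF Comp_Hom[OF h(1) \<beta>]] Comp_assoc[OF h(1) \<beta> g] by auto
    have "\<alpha> \<cdot> f \<cdot> u = h" using Comp_assoc[OF u(1) f \<alpha>] u(2) Comp_assoc[OF h(1) \<beta> \<alpha>] \<alpha>\<beta> Ide_Comp[OF h(1)] by simp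
    then show "\<exists>u \<in> Hom A W X. \<alpha> \<cdot> f \<cdot> u = h" using u by blast
  qed
  then show "N \<in> extensions A U V" using extensionsI[OF \<alpha>f g\<beta> epi_kernel_exact[OF \<alpha>f g\<beta> epi]] XY by blast
qed

text \<open>The left exactness of \<open>Hom(_, W)\<close>, in the form needed for orthogonality of extension classes.\<close>
lemma Zero_from_extension:
  assumes M: "M \<in> extensions A U V" and h: "h \<in> Hom A M W"
    and zero: "\<And>X x. X \<in> U \<union> V \<Longrightarrow> x \<in> Hom A X W \<Longrightarrow> x = Zero A X W"
  shows "h = Zero A M W"
proof -
  obtain X Y f g where XY: "X \<in> U" "Y \<in> V" and f: "f \<in> Hom A X M" and g: "g \<in> Hom A M Y"
    and ck: "is_cokernel A g f"
    using extensionsE[OF M] by metis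
  have "h \<cdot> f = Zero A X W" using zero[OF _ Comp_Hom[OF f h]] XY by blast
  then obtain u where u: "u \<in> Hom A Y W" "u \<cdot> g = h" using cokernel_factor[OF ck f g h] by blast
  then show ?thesis using zero[OF _ u(1)] XY Zero_Comp[OF g] Hom_Obj[OF h] by simp
qed

lemma Zero_to_extension:
  assumes "M \<in> extensions A U V" and "h \<in> Hom A W M"
    and "\<And>X x. X \<in> U \<union> V \<Longrightarrow> x \<in> Hom A W X \<Longrightarrow> x = Zero A W X"
  shows "h = Zero A W M"
  by (rule abelian_category.Zero_from_extension[OF abelian_category_opp, unfolded opp_simps, OF assms(1,2)])
    (use assms(3) in blast)

text \<open>Start with a left \<open>V\<close>-approximation \<open>\<alpha> : M \<rightarrow> T\<close> and make it epi by adding an epimorphism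
  \<open>\<pi> : P \<rightarrow> T\<close> from a projective. The sequence \<open>0 \<rightarrow> K \<rightarrow> M \<oplus> P \<rightarrow> T \<rightarrow> 0\<close> is pushed out along a left \<open>U\<close>-approximation
  \<open>l : K \<rightarrow> C\<close>; the result \<open>0 \<rightarrow> C \<rightarrow> E \<rightarrow> T \<rightarrow> 0\<close> lies in the extension class, and \<open>M \<rightarrow> M \<oplus> P \<rightarrow> E\<close> is the
  approximation. Given \<open>h : M \<rightarrow> X\<close> with \<open>X\<close> an extension of \<open>X\<^sub>2 \<in> V\<close> by \<open>X\<^sub>1 \<in> U\<close>, the composite
  \<open>M \<rightarrow> X\<^sub>2\<close> factors through \<open>\<alpha>\<close>, say by \<open>v\<close>. Projectivity lifts \<open>v \<pi>\<close> to \<open>X\<close>, which extends \<open>h\<close> to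
  \<open>M \<oplus> P\<close> compatibly with \<open>v\<close>; on \<open>K\<close> this extension lands in \<open>X\<^sub>1\<close>, hence factors through \<open>l\<close>, and the
  universal property of \<open>E\<close> applies.\<close>
lemma extensions_covariantly_finite:
  assumes U: "covariantly_finite A U" and V: "covariantly_finite A V" and proj: "enough_projectives A"
  shows "covariantly_finite A (extensions A U V)"
  unfolding covariantly_finite_def
proof
  fix M assume M: "M \<in> Obj A"
  obtain T \<alpha> where T: "T \<in> V" and \<alpha>: "\<alpha> \<in> Hom A M T"
    and apV: "\<And>X h. X \<in> V \<Longrightarrow> h \<in> Hom A M X \<Longrightarrow> \<exists>u \<in> Hom A T X. u \<cdot> \<alpha> = h"
    using V M unfolding covariantly_finite_def left_approximation_def by blast
  obtain P \<pi> where P: "projective A P" and \<pi>: "\<pi> \<in> Hom A P T" and epi: "is_epi A \<pi>"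
    using proj Hom_Obj[OF \<alpha>] unfolding enough_projectives_def by blast
  obtain B i j p q where bp: "is_biproduct A M P B i j p q" using ex_biproduct[OF M] Hom_Obj[OF \<pi>] by blast
  note b = biproductD[OF bp]
  obtain e where e: "e \<in> Hom A B T" "e \<cdot> i = \<alpha>" "e \<cdot> j = \<pi>" using biproduct_copair[OF bp \<alpha> \<pi>] .
  have epi_e: "is_epi A e" using epi_second_factor[OF _ b(2) e(1)] e(3) epi by simp
  obtain K k where k: "k \<in> Hom A K B" and ker: "is_kernel A k e" using obtain_kernel[OF e(1)] .
  have ck: "is_cokernel A e k" using epi_kernel_exact[OF k e(1) epi_e ker] by (simp add: short_exact_def)
  note k' = kernelD[OF ker k e(1)]
  obtain C l where C: "C \<in> U" and l: "l \<in> Hom A K C"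
    and apU: "\<And>X h. X \<in> U \<Longrightarrow> h \<in> Hom A K X \<Longrightarrow> \<exists>u \<in> Hom A C X. u \<cdot> l = h"
    using U Hom_Obj[OF k] unfolding covariantly_finite_def left_approximation_def by blast
  obtain E a c where po: "is_pushout A K B C E k l a c" using obtain_pushout[OF k l] .
  note d = pushoutD[OF po]
  obtain g where g: "g \<in> Hom A E T" "g \<cdot> a = e" "is_cokernel A g c" using pushout_cokernel[OF po e(1) ck] .
  have "short_exact A c g" using mono_cokernel_exact[OF d(4) g(1) pushout_mono[OF po k'(2)] g(3)] .
  then have E: "E \<in> extensions A U V" using extensionsI[OF d(4) g(1)] C T by blast
  have "\<exists>u \<in> Hom A E X. u \<cdot> (a \<cdot> i) = h" if X: "X \<in> extensions A U V" and h: "h \<in> Hom A M X" for X h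
  proof -
    obtain X\<^sub>1 X\<^sub>2 m n where X12: "X\<^sub>1 \<in> U" "X\<^sub>2 \<in> V" and m: "m \<in> Hom A X\<^sub>1 X" and n: "n \<in> Hom A X X\<^sub>2"
      and ker': "is_kernel A m n" and ck': "is_cokernel A n m"
      using extensionsE[OF X] .
    obtain v where v: "v \<in> Hom A T X\<^sub>2" "v \<cdot> \<alpha> = n \<cdot> h" using apV[OF X12(2) Comp_Hom[OF h n]] by blast
    have "v \<cdot> \<pi> \<in> Hom A P (Cod A n)" using Comp_Hom[OF \<pi> v(1)] HomD(3)[OF n] by simp
    then have "\<exists>y \<in> Hom A P (Dom A n). n \<cdot> y = v \<cdot> \<pi>"
      using P cokernel_epi[OF ck' m n] unfolding projective_def by blast
    then obtain y where y: "y \<in> Hom A P X" "n \<cdot> y = v \<cdot> \<pi>" using HomD(2)[OF n] by auto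
    obtain w where w: "w \<in> Hom A B X" "w \<cdot> i = h" "w \<cdot> j = y" using biproduct_copair[OF bp h y(1)] .
    \<comment> \<open>the lift over \<open>v\<close> of the whole of \<open>M \<oplus> P\<close>\<close>
    have nw: "n \<cdot> w = v \<cdot> e"
    proof (rule biproduct_hom_eq[OF bp Comp_Hom[OF w(1) n] Comp_Hom[OF e(1) v(1)]])
      show "n \<cdot> w \<cdot> i = v \<cdot> e \<cdot> i" using Comp_assoc[OF b(1) w(1) n] Comp_assoc[OF b(1) e(1) v(1)] w e v by simp
      show "n \<cdot> w \<cdot> j = v \<cdot> e \<cdot> j" using Comp_assoc[OF b(2) w(1) n] Comp_assoc[OF b(2) e(1) v(1)] w e y by simp
    qed
    have "n \<cdot> (w \<cdot> k) = Zero A K X\<^sub>2"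
      using Comp_assoc[OF k w(1) n] Comp_assoc[OF k e(1) v(1)] nw k'(1) Comp_Zero[OF v(1)] Hom_Obj[OF k] by simp
    then obtain x where x: "x \<in> Hom A K X\<^sub>1" "m \<cdot> x = w \<cdot> k"
      using kernel_factor[OF ker' m n Comp_Hom[OF k w(1)]] by blast
    obtain z where z: "z \<in> Hom A C X\<^sub>1" "z \<cdot> l = x" using apU[OF X12(1) x(1)] by blast
    have "w \<cdot> k = m \<cdot> z \<cdot> l" using Comp_assoc[OF l z(1) m] z x by simp
    then obtain u where u: "u \<in> Hom A E X" "u \<cdot> a = w" using d(6)[OF w(1) Comp_Hom[OF z(1) m]] by blast
    then have "u \<cdot> (a \<cdot> i) = h" using Comp_assoc[OF b(1) d(3) u(1)] w by simp
    then show ?thesis using u by blast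
  qed
  then have "left_approximation A (extensions A U V) M (a \<cdot> i)"
    unfolding left_approximation_def using E Comp_Hom[OF b(1) d(3)] by blast
  then show "\<exists>f. left_approximation A (extensions A U V) M f" by blast
qed

end

section \<open>Lifting torsion pairs from the interval\<close>

context torsion_interval
begin

text \<open>The sequence of \<open>M\<close> is \<open>X \<rightarrow> M \<rightarrow> Y\<close>, where \<open>M\<^sub>1\<close> is the \<open>C'\<close>-part of \<open>M\<close>, \<open>N\<close> is the \<open>D\<close>-quotient of
  \<open>M\<^sub>1\<close>, \<open>T\<^sub>0\<close> is the \<open>T\<close>-part of \<open>N\<close> in the heart, and \<open>X\<close> is the preimage of \<open>T\<^sub>0\<close> in \<open>M\<^sub>1\<close>. That \<open>M\<^sub>1/X\<close> is
  the \<open>F\<close>-quotient of \<open>N\<close> relies on \<open>heart_short_exact\<close>.\<close>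
lemma lifted_torsion_pair:
  assumes htp: "torsion_pair heart T F"
  shows "torsion_pair A (extensions A C T) (extensions A F D')"
proof -
  have TF: "T \<subseteq> C' \<inter> D" "F \<subseteq> C' \<inter> D" using torsion_pairD(1,2)[OF htp] by auto
  show ?thesis
    unfolding torsion_pair_def
  proof (intro conjI ballI iso_closed_extensions pre_abelian_category_axioms)
    show "extensions A C T \<subseteq> Obj A" "extensions A F D' \<subseteq> Obj A" by (auto simp: extensions_def)
    fix U V assume U: "U \<in> extensions A C T" and V: "V \<in> extensions A F D'"
    have "x = Zero A X Y" if "X \<in> C \<union> T" "Y \<in> F \<union> D'" and x: "x \<in> Hom A X Y" for X Y x
    proof (cases "X \<in> T \<and> Y \<in> F")
      case True
      then have "x \<in> Hom heart X Y" using x TF by (auto simp: Hom_full)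
      then show ?thesis using torsion_hom[OF htp, of X Y x] True by simp
    next
      case False
      then show ?thesis
        using torsion_hom[OF tp _ _ x] torsion_hom[OF tp' _ _ x] that C_sub D'_sub TF by blast
    qed
    then have "h = Zero A U V" if h: "h \<in> Hom A U V" for h
      using Zero_from_extension[OF U h] Zero_to_extension[OF V] by blast
    moreover have "Zero A U V \<in> Hom A U V" using U V Zero_Hom by (simp add: extensions_def)
    ultimately show "Hom A U V = {Zero A U V}" by blast
  next
    fix M assume M: "M \<in> Obj A"
    obtain M\<^sub>1 M\<^sub>2 i d where M12: "M\<^sub>1 \<in> C'" "M\<^sub>2 \<in> D'" and i: "i \<in> Hom A M\<^sub>1 M" and d: "d \<in> Hom A M M\<^sub>2"
      and id: "short_exact A i d"
      using torsion_sequence[OF tp' M] by blast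
    obtain M\<^sub>0 N j q where M0N: "M\<^sub>0 \<in> C" "N \<in> D" and j: "j \<in> Hom A M\<^sub>0 M\<^sub>1" and q: "q \<in> Hom A M\<^sub>1 N"
      and jq: "short_exact A j q"
      using torsion_sequence[OF tp] Hom_Obj[OF i] by blast
    have epi_q: "is_epi A q" using cokernel_epi[OF _ j q] jq by (simp add: short_exact_def)
    have N: "N \<in> C' \<inter> D" using torsion_quotient[OF tp' M12(1) q epi_q] M0N by blast
    then have "N \<in> Obj heart" using Hom_Obj[OF q] by simp
    then obtain T\<^sub>0 F\<^sub>0 t g where TF0: "T\<^sub>0 \<in> T" "F\<^sub>0 \<in> F" and t: "t \<in> Hom heart T\<^sub>0 N" and g: "g \<in> Hom heart N F\<^sub>0"
      and "short_exact heart t g"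
      using torsion_sequence[OF htp] by blast
    moreover have t: "t \<in> Hom A T\<^sub>0 N" and g: "g \<in> Hom A N F\<^sub>0" using t g by (simp_all add: Hom_full)
    ultimately have tg: "short_exact A t g" using heart_short_exact[OF t g _ N] TF by blast
    have gq: "g \<cdot> q \<in> Hom A M\<^sub>1 F\<^sub>0" using Comp_Hom[OF q g] .
    have "is_epi A g" using cokernel_epi[OF _ t g] tg by (simp add: short_exact_def)
    then have epi: "is_epi A (g \<cdot> q)" using epi_Comp[OF epi_q _ q g] by blast
    obtain X k where k: "k \<in> Hom A X M\<^sub>1" and ker: "is_kernel A k (g \<cdot> q)" using obtain_kernel[OF gq] .
    have ke: "short_exact A k (g \<cdot> q)" using epi_kernel_exact[OF k gq epi ker] .
    have X: "X \<in> extensions A C T"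
      using third_isomorphism_dual[OF j q jq t g tg k ker] extensionsI M0N TF0 by blast
    have ik: "i \<cdot> k \<in> Hom A X M" using Comp_Hom[OF k i] .
    obtain Y c where c: "c \<in> Hom A M Y" and ck: "is_cokernel A c (i \<cdot> k)" using obtain_cokernel[OF ik] .
    have Y: "Y \<in> extensions A F D'"
      using third_isomorphism[OF i d id k gq ke c ck] extensionsI M12 TF0 by blast
    have "is_mono A i" using kernel_mono[OF _ i d] id by (simp add: short_exact_def)
    then have "short_exact A (i \<cdot> k) c"
      using mono_cokernel_exact[OF ik c mono_Comp[OF kernel_mono[OF ker k gq] _ k i] ck] by blast
    then show "\<exists>X \<in> extensions A C T. \<exists>Y \<in> extensions A F D'. \<exists>f \<in> Hom A X M. \<exists>g \<in> Hom A M Y.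
        short_exact A f g"
      using X Y ik c by blast
  qed
qed

text \<open>The heart itself is covariantly finite in \<open>A\<close>: it is the case \<open>X = C'\<close> of
  \<open>left_approximation_torsion_free_part\<close>.\<close>
lemma heart_covariantly_finite_lift:
  assumes fin: "covariantly_finite A C'" and T: "T \<subseteq> C' \<inter> D" and finT: "covariantly_finite heart T"
  shows "covariantly_finite A T"
  unfolding covariantly_finite_def
proof
  fix M assume "M \<in> Obj A"
  then obtain f where f: "left_approximation A (C' \<inter> D) M f"
    using left_approximation_torsion_free_part[OF tp' fin] by blast
  then obtain N where N: "N \<in> C' \<inter> D" and f': "f \<in> Hom A M N" unfolding left_approximation_def by blast
  then have "N \<in> Obj heart" using Hom_Obj[OF f'] by simp
  then obtain g where "left_approximation heart T N g" using finT unfolding covariantly_finite_def by blast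
  then show "\<exists>h. left_approximation A T M h" using left_approximation_trans[OF f f' _ T] by blast
qed

lemma lifted_torsion_class_functorially_finite:
  assumes htp: "torsion_pair heart T F" and finT: "covariantly_finite heart T"
    and fin: "covariantly_finite A C" "covariantly_finite A C'" and proj: "enough_projectives A"
  shows "functorially_finite A (extensions A C T)"
proof -
  have "T \<subseteq> C' \<inter> D" using torsion_pairD(1)[OF htp] by simp
  then have "covariantly_finite A T" using heart_covariantly_finite_lift fin(2) finT by blast
  then show ?thesis
    using extensions_covariantly_finite[OF fin(1) _ proj]
      torsion_contravariantly_finite[OF lifted_torsion_pair[OF htp]]
    by (simp add: functorially_finite_def)
qed

lemma lifted_torsion_free_class_functorially_finite:
  assumes "torsion_pair heart T F" and "contravariantly_finite heart F"
    and "contravariantly_finite A D'" "contravariantly_finite A D" and "enough_injectives A"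
  shows "functorially_finite A (extensions A F D')"
  using torsion_interval.lifted_torsion_class_functorially_finite[OF torsion_interval_opp,
      unfolded interval_opp_simps torsion_pair_opp] assms by blast

proposition lifted_ff_torsion_pair:
  assumes "enough_projectives A" "enough_injectives A"
    and "ff_torsion_pair A C D" "ff_torsion_pair A C' D'" and "ff_torsion_pair heart T F"
  shows "ff_torsion_pair A (extensions A C T) (extensions A F D')"
  using assms lifted_torsion_pair lifted_torsion_class_functorially_finite
    lifted_torsion_free_class_functorially_finite
  unfolding ff_torsion_pair_def functorially_finite_def by blast

end

theorem proposition4p8:
  fixes A :: "('o, 'm) precat" and C D C' D' :: "'o set"
  assumes "abelian_category A"
    and "torsion_pair A C D" and "torsion_pair A C' D'"
    and "C \<subseteq> C'"
  shows
    "(\<forall>X Y. ff_torsion_pair A X Y \<and> C \<subseteq> X \<and> X \<subseteq> C' \<longrightarrow>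
        ff_torsion_pair (full_subcat A (C' \<inter> D)) (X \<inter> D) (Y \<inter> C'))
     \<and>
     (enough_projectives A \<and> enough_injectives A \<and>
        ff_torsion_pair A C D \<and> ff_torsion_pair A C' D' \<longrightarrow>
        (\<forall>T F. ff_torsion_pair (full_subcat A (C' \<inter> D)) T F \<longrightarrow>
           ff_torsion_pair A (extensions A C T) (extensions A F D')))"
proof -
  interpret torsion_interval A C D C' D'
    using assms by (simp add: torsion_interval_def torsion_interval_axioms_def)
  show ?thesis using heart_ff_torsion_pair lifted_ff_torsion_pair by blast
qed

end
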